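(* Let $k$ be a positive integer and $n$ an even positive integer. If $G$ is a connected graph on $n$ vertices with $\rho(G)\geqslant\rho\big(K_{2k}\vee(K_{n-2k-1}\cup K_1)\big)$, then $G$ is $k$-extendable, unless $G\cong K_{2k}\vee(K_{n-2k-1}\cup K_1)$.
   Context: All graphs are finite, simple and undirected. $\rho(G)$ denotes the spectral radius (largest eigenvalue) of the adjacency matrix of $G$. A graph with at least $2k+2$ vertices that has a perfect matching is called $k$-extendable if every matching of size $k$ is contained in some perfect matching. $K_r$ is the complete graph on $r$ vertices; $G_1\cup G_2$ is the disjoint union; the join $G_1\vee G_2$ is obtained from $G_1\cup G_2$ by adding all edges between $V(G_1)$ and $V(G_2)$. *)

theory Defs
  imports "Jordan_Normal_Form.Spectral_Radius" "HOL-Library.Countable_Set"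
    "HOL-Library.Disjoint_Sets"
begin

record 'a ugraph =
  verts :: "'a set"
  edges :: "'a set set"

definition simple_graph :: "'a ugraph \<Rightarrow> bool" where
  "simple_graph G \<longleftrightarrow>
     finite (verts G) \<and> (\<forall>e \<in> edges G. e \<subseteq> verts G \<and> card e = 2)"

definition graph_connected :: "'a ugraph \<Rightarrow> bool" where
  "graph_connected G \<longleftrightarrow> verts G \<noteq> {} \<and>
     (\<forall>u \<in> verts G. \<forall>v \<in> verts G. (u, v) \<in> {(x, y). {x, y} \<in> edges G}\<^sup>*)"

definition graph_iso :: "'a ugraph \<Rightarrow> 'b ugraph \<Rightarrow> bool" where
  "graph_iso G H \<longleftrightarrow>
     (\<exists>f. bij_betw f (verts G) (verts H) \<and>
          (\<forall>u \<in> verts G. \<forall>v \<in> verts G. {u, v} \<in> edges G \<longleftrightarrow> {f u, f v} \<in> edges H))"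

definition complete_graph :: "nat \<Rightarrow> nat ugraph" where
  "complete_graph r =
     \<lparr>verts = {..<r}, edges = {{u, v} | u v. u < r \<and> v < r \<and> u \<noteq> v}\<rparr>"

definition graph_union :: "'a ugraph \<Rightarrow> 'b ugraph \<Rightarrow> ('a + 'b) ugraph" where
  "graph_union G H =
     \<lparr>verts = verts G <+> verts H,
      edges = (`) Inl ` edges G \<union> (`) Inr ` edges H\<rparr>"

definition graph_join :: "'a ugraph \<Rightarrow> 'b ugraph \<Rightarrow> ('a + 'b) ugraph" where
  "graph_join G H =
     \<lparr>verts = verts (graph_union G H),
      edges = edges (graph_union G H) \<union>
              {{Inl u, Inr v} | u v. u \<in> verts G \<and> v \<in> verts H}\<rparr>"

(* For finite V, from_nat_into V enumerates V bijectively on {..<card V}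
   (bij_betw_from_nat_into_finite). Another enumeration conjugates the matrix by a
   permutation matrix, so the spectrum does not depend on this choice. *)
definition adjacency_matrix :: "'a ugraph \<Rightarrow> real mat" where
  "adjacency_matrix G =
     mat (card (verts G)) (card (verts G))
       (\<lambda>(i, j). if {from_nat_into (verts G) i, from_nat_into (verts G) j} \<in> edges G
                then 1 else 0)"

(* The largest eigenvalue. The matrix is real symmetric, so for a nonempty vertex set
   its real spectrum is its whole spectrum and is nonempty. *)
definition graph_rho :: "'a ugraph \<Rightarrow> real" where
  "graph_rho G = Max (spectrum (adjacency_matrix G))"

definition matching :: "'a ugraph \<Rightarrow> 'a set set \<Rightarrow> bool" where
  "matching G M \<longleftrightarrow> M \<subseteq> edges G \<and> disjoint M"

definition perfect_matching :: "'a ugraph \<Rightarrow> 'a set set \<Rightarrow> bool" where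
  "perfect_matching G M \<longleftrightarrow> matching G M \<and> \<Union>M = verts G"

definition k_extendable :: "nat \<Rightarrow> 'a ugraph \<Rightarrow> bool" where
  "k_extendable k G \<longleftrightarrow>
     2 * k + 2 \<le> card (verts G) \<and>
     (\<exists>M. perfect_matching G M) \<and>
     (\<forall>M. matching G M \<and> card M = k \<longrightarrow> (\<exists>M'. perfect_matching G M' \<and> M \<subseteq> M'))"

end

theory Submission
  imports Defs
begin

text \<open>If \<open>G\<close> is not \<open>k\<close>-extendable, then \<open>G - U\<close> has no perfect matching for some set \<open>U\<close> of \<open>2k\<close>
  vertices.  As in Tutte's theorem, this gives a set \<open>T\<close> such that \<open>G - U - T\<close> has at least
  \<open>t + 2\<close> components, where \<open>t = \<bar>T\<bar>\<close>; let \<open>S = U \<union> T\<close> and \<open>s = 2k + t\<close>.  Let \<open>\<mu> - 1\<close> be the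
  eigenvalue of the extremal graph with a positive eigenvector.  The vector \<open>z\<close> which is \<open>1\<close> on \<open>S\<close>
  and \<open>s / (\<mu> - c)\<close> on a component of order \<open>c\<close> satisfies \<open>A z \<le> (\<mu> - 1) z\<close>, so the spectral radius
  of \<open>G\<close> is at most \<open>\<mu> - 1\<close>, and equality forces all these inequalities to be equalities.  The
  inequality at \<open>S\<close> follows from convexity of \<open>c / (\<mu> - c)\<close> and is strict unless \<open>t = 0\<close> and
  the components have orders \<open>1\<close> and \<open>n - 2k - 1\<close>.\<close>

section \<open>Graphs without a perfect matching\<close>

text \<open>A perfect matching of the graph induced on \<open>W\<close>, encoded as a
  fixed-point-free involution. \<open>E\<close> is a bare set of sets, so that edges can be added
  freely.\<close>

definition paired :: "'a set set \<Rightarrow> 'a set \<Rightarrow> bool" where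
  "paired E W \<longleftrightarrow> (\<exists>f. \<forall>v\<in>W. f v \<in> W \<and> f (f v) = v \<and> f v \<noteq> v \<and> {v, f v} \<in> E)"

lemma paired_insert_edge:
  assumes "paired E (W - {u, v})" "u \<in> W" "v \<in> W" "u \<noteq> v" "{u, v} \<in> E"
  shows "paired E W"
proof -
  from assms(1) obtain f where
    f: "\<And>w. w \<in> W - {u, v} \<Longrightarrow> f w \<in> W - {u, v} \<and> f (f w) = w \<and> f w \<noteq> w \<and> {w, f w} \<in> E"
    unfolding paired_def by blast
  have "{v, u} \<in> E" using assms(5) by (simp add: insert_commute)
  then show ?thesis unfolding paired_def using assms f
    by (intro exI[of _ "f(u := v, v := u)"]) (auto simp: insert_commute)
qed

text \<open>Induction, deleting edges of a would-be matching. An edge outside \<open>T\<close> is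
  deleted without changing \<open>T\<close>. If \<open>W - T\<close> is independent and has at most
  \<open>card T\<close> vertices, a vertex of \<open>T\<close>, being adjacent to everything, is
  matched into \<open>W - T\<close> where possible; the smaller instance then demands an independent
  set larger than \<open>W - T\<close>.\<close>

lemma unpaired_independent_set:
  assumes "finite W" "even (card W)" "\<not> paired E W" "T \<subseteq> W"
    and "\<And>v w. v \<in> T \<Longrightarrow> w \<in> W \<Longrightarrow> v \<noteq> w \<Longrightarrow> {v, w} \<in> E"
  shows "\<exists>I \<subseteq> W - T. card T + 2 \<le> card I \<and> (\<forall>u\<in>I. \<forall>v\<in>I. u \<noteq> v \<longrightarrow> {u, v} \<notin> E)"
  using assms
proof (induction "card W" arbitrary: W T rule: less_induct)
  case less
  have finT: "finite T" using less.prems finite_subset by blast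
  have remove: "card (W - {u, v}) < card W \<and> even (card (W - {u, v})) \<and> \<not> paired E (W - {u, v})"
    if "u \<in> W" "v \<in> W" "u \<noteq> v" "{u, v} \<in> E" for u v
  proof -
    have "card (W - {u, v}) = card W - 2" using that less.prems(1)
      by (subst card_Diff_subset) auto
    moreover have "card {u, v} \<le> card W" using that less.prems(1) by (intro card_mono) auto
    ultimately show ?thesis using that less.prems(2,3) paired_insert_edge[of E W u v] by auto
  qed
  consider (inner) u v where "u \<in> W - T" "v \<in> W - T" "u \<noteq> v" "{u, v} \<in> E"
    | (indep) "\<forall>u\<in>W - T. \<forall>v\<in>W - T. u \<noteq> v \<longrightarrow> {u, v} \<notin> E" by blast
  then show ?case
  proof cases
    case inner
    have "\<exists>I \<subseteq> (W - {u, v}) - T. card T + 2 \<le> card I \<and>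
        (\<forall>u\<in>I. \<forall>v\<in>I. u \<noteq> v \<longrightarrow> {u, v} \<notin> E)"
      using inner remove[of u v] less.prems by (intro less.hyps) auto
    then show ?thesis by (elim exE conjE, intro exI conjI) auto
  next
    case indep
    show ?thesis
    proof (cases "card T + 2 \<le> card (W - T)")
      case True
      then show ?thesis using indep by blast
    next
      case False
      have cW: "card W = card T + card (W - T)"
        using less.prems finT by (simp add: card_Diff_subset card_mono)
      have "W \<noteq> {}" using less.prems(3) unfolding paired_def by auto
      then have W0: "card W \<ge> 2" using less.prems(1,2)
        by (metis card_0_eq dvd_imp_le gr0I)
      \<comment> \<open>\<open>card W\<close> is even, which excludes
        \<open>card (W - T) = card T + 1\<close>.\<close>
      have le: "card (W - T) \<le> card T" using False cW less.prems(2)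
        by (metis even_add not_less_eq_eq add_2_eq_Suc' le_SucE even_Suc)
      have "card T > 0" using W0 cW le by linarith
      then obtain v where v: "v \<in> T" by fastforce
      \<comment> \<open>Whenever possible \<open>u\<close> lies outside \<open>T\<close>, so that
        deleting \<open>u\<close> and \<open>v\<close> costs \<open>T\<close> a single
        vertex.\<close>
      obtain u where u: "u \<in> W" "u \<noteq> v" and uT: "W - T \<noteq> {} \<Longrightarrow> u \<in> W - T"
      proof (cases "W - T = {}")
        case True
        have "\<exists>u\<in>W. u \<noteq> v"
        proof (rule ccontr)
          assume "\<not> ?thesis"
          then have "W \<subseteq> {v}" by auto
          then show False using W0 card_mono[of "{v}" W] by auto
        qed
        then show ?thesis using that True by auto
      next
        case False
        then show ?thesis using that v by auto
      qed
      have e: "{u, v} \<in> E" using less.prems(5)[OF v, of u] u by (simp add: insert_commute)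
      have vW: "v \<in> W" using v less.prems(4) by auto
      have "\<exists>I \<subseteq> (W - {u, v}) - (T - {u, v}). card (T - {u, v}) + 2 \<le> card I \<and>
          (\<forall>u\<in>I. \<forall>v\<in>I. u \<noteq> v \<longrightarrow> {u, v} \<notin> E)"
        using u vW e remove[of u v] less.prems by (intro less.hyps) auto
      then obtain I where I0: "I \<subseteq> (W - {u, v}) - (T - {u, v})"
        and I: "card (T - {u, v}) + 2 \<le> card I" by (elim exE conjE)
      have IW: "I \<subseteq> W - T" using I0 by auto
      have "card I \<le> card (W - T)" using IW less.prems(1) by (intro card_mono) auto
      moreover have "card T \<le> card (T - {u, v}) + 1" if "W - T \<noteq> {}"
      proof -
        have "T - {u, v} = T - {v}" using uT[OF that] by auto
        then show ?thesis using finT v by (simp add: card_Diff_singleton)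
      qed
      ultimately have False using I le by (cases "W - T = {}") auto
      then show ?thesis ..
    qed
  qed
qed

text \<open>The Lovasz step in the proof of Tutte's theorem.  With \<open>f\<close> and \<open>g\<close> the perfect
  matchings of \<open>E + xz\<close> and \<open>E + yw\<close>, the vertices reached from \<open>y\<close> along alternating edges are
  those of the form \<open>(g \<circ> f)\<^sup>i y\<close> and \<open>f ((g \<circ> f)\<^sup>i y)\<close>.  If this component avoids \<open>xz\<close>, use \<open>f\<close>
  on it and \<open>g\<close> elsewhere.  Otherwise cut it at the first even vertex in \<open>{x, z}\<close>; use \<open>g\<close> on the
  initial piece, match \<open>y\<close> with the other of \<open>x, z\<close>, and use \<open>f\<close> elsewhere.\<close>

lemma alternating_exchange:
  assumes fin: "finite W"
    and f: "\<And>v. v \<in> W \<Longrightarrow> f v \<in> W \<and> f (f v) = v \<and> f v \<noteq> v \<and> {v, f v} \<in> insert {x, z} E"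
    and g: "\<And>v. v \<in> W \<Longrightarrow> g v \<in> W \<and> g (g v) = v \<and> g v \<noteq> v \<and> {v, g v} \<in> insert {y, w} E"
    and mem: "x \<in> W" "y \<in> W" "z \<in> W" "w \<in> W"
    and dist: "x \<noteq> z" "x \<noteq> y" "y \<noteq> z" "w \<noteq> y"
    and fx: "f x = z" and gy: "g y = w"
    and xy: "{x, y} \<in> E" and yz: "{y, z} \<in> E"
  shows "paired E W"
proof -
  \<comment> \<open>\<open>p i\<close> are the vertices at even positions of the alternating walk
    from \<open>y\<close>, and \<open>f (p i)\<close> those at odd positions.\<close>
  define p where "p i = ((g \<circ> f) ^^ i) y" for i :: nat
  have p0: "p 0 = y" and pS: "p (Suc i) = g (f (p i))" for i
    by (simp_all add: p_def)
  have pW: "p i \<in> W" for i by (induction i) (use mem f g p0 pS in auto)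
  have fpW: "f (p i) \<in> W" for i using f pW by auto
  have fz: "f z = x" and gw: "g w = y" using f g fx gy mem by metis+
  have fE: "{v, f v} \<in> E" if "v \<in> W" "v \<notin> {x, z}" for v
    using f[OF that(1)] that by (auto simp: doubleton_eq_iff)
  have gE: "{v, g v} \<in> E" if "v \<in> W" "v \<notin> {y, w}" for v
    using g[OF that(1)] that by (auto simp: doubleton_eq_iff)
  have shift: "f (p (Suc i)) = p j \<longleftrightarrow> f (p i) = p (Suc j)" for i j
    using f g pW fpW pS by metis
  \<comment> \<open>\<open>f (p i) = p j\<close> would give
    \<open>f (p (Suc i)) = p (j - 1)\<close>; moving both ends inwards leads to a fixed point of
    \<open>f\<close> or of \<open>g\<close>.\<close>
  have sep_aux: "f (p i) \<noteq> p j \<and> f (p j) \<noteq> p i" if "i \<le> j" for i j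
    using that
  proof (induction "j - i" arbitrary: i j rule: less_induct)
    case less
    consider "j = i" | "j = Suc i" | "Suc (Suc i) \<le> j" using less.prems by linarith
    then show ?case
    proof cases
      case 1
      then show ?thesis using f[OF pW[of i]] by auto
    next
      case 2
      then show ?thesis using g[OF fpW[of i]] pS[of i] f pW by metis
    next
      case 3
      then obtain j' where j: "j = Suc j'" "Suc i \<le> j'" by (cases j) auto
      have "f (p (Suc i)) \<noteq> p j'" using less.hyps[of j' "Suc i"] j by auto
      then have "f (p i) \<noteq> p j" using shift[of i j'] j by simp
      then show ?thesis using f pW by metis
    qed
  qed
  then have sep: "f (p i) \<noteq> p j" for i j using linear by metis
  show ?thesis
  proof (cases "\<exists>i. p i \<in> {x, z}")
    case False
    define K where "K = {v. \<exists>i. v = p i \<or> v = f (p i)}"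
    have inj: "p i = p j" if "p (Suc i) = p (Suc j)" for i j
      using that f g pW fpW pS by metis
    \<comment> \<open>The walk repeats a vertex since \<open>W\<close> is finite, and its steps are
      reversible, so the repetition can be shifted back to \<open>y\<close>. Hence \<open>w\<close>
      lies in \<open>K\<close> as well.\<close>
    have "\<exists>N. p (Suc N) = y"
    proof -
      have "\<not> inj p" using fin pW
        by (meson finite_subset image_subsetI infinite_iff_countable_subset)
      then obtain i j where ij: "i < j" "p i = p j"
        unfolding inj_def by (metis linorder_neqE_nat)
      have "p (Suc N) = y" if "p i = p (i + Suc N)" for i N
        using that
      proof (induction i)
        case 0
        then show ?case using p0 by simp
      next
        case (Suc i)
        then show ?case using inj[of i "i + Suc N"] by simp
      qed
      then show ?thesis using ij less_imp_Suc_add[OF ij(1)] by fastforce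
    qed
    then obtain N where N: "g (f (p N)) = y" using pS by auto
    then have wN: "w = f (p N)" using g[OF fpW[of N]] gy by auto
    have fK: "f v \<in> K" if "v \<in> K" for v
      using that f pW unfolding K_def by auto
    have gK: "g v \<in> K" if v: "v \<in> K" for v
    proof -
      consider i where "v = p i" | i where "v = f (p i)" using v K_def by auto
      then show ?thesis
      proof cases
        case 1
        show ?thesis
        proof (cases i)
          case 0
          then show ?thesis using 1 p0 gy wN K_def by auto
        next
          case (Suc j)
          then have "g v = f (p j)" using 1 pS[of j] g[OF fpW[of j]] by auto
          then show ?thesis unfolding K_def by auto
        qed
      next
        case 2
        then have "g v = p (Suc i)" using pS[of i] by simp
        then show ?thesis unfolding K_def by blast
      qed
    qed
    have KW: "K \<subseteq> W" using pW fpW K_def by auto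
    have yK: "y \<in> K" "w \<in> K" using wN p0 K_def by auto
    have xK: "v \<notin> {x, z}" if vK: "v \<in> K" for v
    proof
      assume "v \<in> {x, z}"
      then obtain i where "v = f (p i)" using vK False K_def by auto
      then have "p i = f v" using f[OF pW[of i]] by metis
      then have "p i \<in> {x, z}" using \<open>v \<in> {x, z}\<close> fx fz by auto
      then show False using False by blast
    qed
    show ?thesis unfolding paired_def
    proof (intro exI[of _ "\<lambda>v. if v \<in> K then f v else g v"] ballI)
      fix v assume v: "v \<in> W"
      show "(if v \<in> K then f v else g v) \<in> W \<and>
          (if (if v \<in> K then f v else g v) \<in> K then f (if v \<in> K then f v else g v)
            else g (if v \<in> K then f v else g v)) = v \<and>
          (if v \<in> K then f v else g v) \<noteq> v \<and> {v, if v \<in> K then f v else g v} \<in> E"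
      proof (cases "v \<in> K")
        case True
        then show ?thesis using f[OF v] fE[OF v] xK fK by auto
      next
        case False
        then have "g v \<notin> K" using gK[of "g v"] g[OF v] by auto
        moreover have "v \<notin> {y, w}" using False yK by auto
        ultimately show ?thesis using False g[OF v] gE[OF v] by auto
      qed
    qed
  next
    case True
    define m where "m = (LEAST i. p i \<in> {x, z})"
    have m: "p m \<in> {x, z}" unfolding m_def using True by (metis (mono_tags, lifting) LeastI_ex)
    have lt: "p i \<notin> {x, z}" if "i < m" for i using not_less_Least that unfolding m_def by blast
    define b where "b = f (p m)"
    have b: "b \<in> {x, z}" "b \<noteq> p m" "f b = p m" "b \<in> W" using m fx fz dist mem b_def by auto
    have yb: "{y, b} \<in> E" using b(1) xy yz by (auto simp: insert_commute)
    \<comment> \<open>An early return to \<open>y\<close> would make the walk periodic, so that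
      \<open>{x, z}\<close> would be met before position \<open>m\<close>.\<close>
    have py: "p (Suc j) \<noteq> y" if "j < m" for j
    proof
      assume per: "p (Suc j) = y"
      have "p (i + Suc j) = p i" for i by (induction i) (use per p0 pS in auto)
      then have "p (m - Suc j) = p m" using that by (metis Suc_leI le_add_diff_inverse2)
      then show False using lt[of "m - Suc j"] m that by simp
    qed
    \<comment> \<open>The initial piece without \<open>y\<close>: within it \<open>g\<close> pairs
      \<open>f (p i)\<close> with \<open>p (Suc i)\<close>, and \<open>y\<close> is left over to be
      matched with \<open>b\<close>.\<close>
    define Q where "Q = (\<lambda>i. p (Suc i)) ` {..<m} \<union> (\<lambda>i. f (p i)) ` {..<m}"
    have QW: "Q \<subseteq> W" using pW fpW Q_def by auto
    have gQ: "g v \<in> Q" if "v \<in> Q" for v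
      using that unfolding Q_def
    proof (elim UnE imageE)
      fix i assume i: "v = p (Suc i)" "i \<in> {..<m}"
      then have "g v = f (p i)" using pS[of i] g[OF fpW[of i]] by auto
      then show "g v \<in> (\<lambda>i. p (Suc i)) ` {..<m} \<union> (\<lambda>i. f (p i)) ` {..<m}" using i by auto
    next
      fix i assume i: "v = f (p i)" "i \<in> {..<m}"
      then have "g v = p (Suc i)" using pS[of i] by auto
      then show "g v \<in> (\<lambda>i. p (Suc i)) ` {..<m} \<union> (\<lambda>i. f (p i)) ` {..<m}" using i by auto
    qed
    have yQ: "y \<notin> Q" unfolding Q_def using py sep[of _ 0] p0 by force
    have bQ: "b \<notin> Q"
    proof
      assume "b \<in> Q"
      then consider i where "i < m" "b = p (Suc i)" | i where "i < m" "b = f (p i)"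
        unfolding Q_def by auto
      then show False
      proof cases
        case 1
        then show False using sep[of m "Suc i"] b_def by simp
      next
        case 2
        then have "p i = p m" using f pW b_def by metis
        then show False using lt[OF 2(1)] m by simp
      qed
    qed
    have bny: "b \<noteq> y" using b dist by auto
    \<comment> \<open>With \<open>y\<close> and \<open>b\<close> added, \<open>Q\<close> consists of
      all \<open>p i\<close> and \<open>f (p i)\<close> with \<open>i \<le> m\<close>. This set is
      closed under the involution \<open>f\<close>, hence so is its complement in
      \<open>W\<close>.\<close>
    have insQ: "f v \<in> insert y (insert b Q) \<Longrightarrow> v \<in> insert y (insert b Q)" if v: "v \<in> W" for v
    proof -
      have pin: "p i \<in> insert y Q" if "i \<le> m" for i
        using that p0 unfolding Q_def by (cases i) auto
      have finb: "f (p i) \<in> insert b Q" if "i \<le> m" for i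
        using that b_def unfolding Q_def by (cases "i = m") auto
      assume "f v \<in> insert y (insert b Q)"
      moreover have "\<exists>i\<le>m. u = p i \<or> u = f (p i)" if "u \<in> insert y (insert b Q)" for u
        using that p0 b_def unfolding Q_def by (auto intro: Suc_leI less_imp_le)
      ultimately obtain i where i: "i \<le> m" "f v = p i \<or> f v = f (p i)" by blast
      then have "v = f (p i) \<or> v = p i" using f v pW by metis
      then show ?thesis using pin[OF i(1)] finb[OF i(1)] by auto
    qed
    have xzQ: "v \<notin> {x, z}" if "v \<notin> insert y (insert b Q)" for v
    proof -
      have "p m \<in> insert y Q" using p0 unfolding Q_def by (cases m) auto
      moreover have "{x, z} = {p m, b}" using m b by auto
      ultimately show ?thesis using that by auto
    qed
    define h where "h v = (if v = y then b else if v = b then y else if v \<in> Q then g v else f v)" for v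
    show ?thesis unfolding paired_def
    proof (intro exI[of _ h] ballI)
      fix v assume v: "v \<in> W"
      consider "v = y" | "v = b" | "v \<in> Q" | "v \<notin> insert y (insert b Q)" by auto
      then show "h v \<in> W \<and> h (h v) = v \<and> h v \<noteq> v \<and> {v, h v} \<in> E"
      proof cases
        case 1
        then show ?thesis using b bny yb unfolding h_def by auto
      next
        case 2
        then show ?thesis using b bny yb mem unfolding h_def by (auto simp: insert_commute)
      next
        case 3
        then have "g v \<in> Q" "v \<noteq> y" "v \<noteq> b" using gQ yQ bQ by auto
        moreover have "v \<noteq> w" using gw \<open>g v \<in> Q\<close> yQ by auto
        ultimately show ?thesis using 3 g[OF v] gE[OF v] yQ bQ unfolding h_def by auto
      next
        case 4
        then have "f v \<notin> insert y (insert b Q)" using insQ[OF v] by auto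
        then show ?thesis using 4 f[OF v] fE[OF v xzQ[OF 4]] unfolding h_def by auto
      qed
    qed
  qed
qed

section \<open>Edge-maximal graphs without a perfect matching\<close>

lemma paired_uses_edge:
  assumes "paired (insert {x, z} E) W" "\<not> paired E W"
  obtains f where
    "\<And>v. v \<in> W \<Longrightarrow> f v \<in> W \<and> f (f v) = v \<and> f v \<noteq> v \<and> {v, f v} \<in> insert {x, z} E"
    "f x = z"
proof -
  from assms(1) obtain f where
    f: "\<And>v. v \<in> W \<Longrightarrow> f v \<in> W \<and> f (f v) = v \<and> f v \<noteq> v \<and> {v, f v} \<in> insert {x, z} E"
    unfolding paired_def by metis
  have "f x = z"
  proof (rule ccontr)
    assume ne: "f x \<noteq> z"
    have "{v, f v} \<in> E" if v: "v \<in> W" for v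
    proof -
      have "{v, f v} \<noteq> {x, z}"
      proof
        assume "{v, f v} = {x, z}"
        then consider "v = x" "f v = z" | "v = z" "f v = x" by (auto simp: doubleton_eq_iff)
        then show False using ne f[OF v] by cases auto
      qed
      then show ?thesis using f[OF v] by auto
    qed
    then have "paired E W" unfolding paired_def using f by (intro exI[of _ f]) auto
    then show False using assms(2) by simp
  qed
  then show thesis using that f by blast
qed

text \<open>If \<open>{x, z}\<close> were missing, adding it or adding \<open>{y, w}\<close> would
  each create a perfect matching, and the two combine into one within \<open>E\<close>. So adjacency
  is transitive at every \<open>y\<close> that is not adjacent to all other vertices.\<close>

lemma saturated_transitive:
  assumes fin: "finite W" and no: "\<not> paired E W"
    and sat: "\<And>x z. x \<in> W \<Longrightarrow> z \<in> W \<Longrightarrow> x \<noteq> z \<Longrightarrow> {x, z} \<notin> E \<Longrightarrow> paired (insert {x, z} E) W"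
    and mem: "x \<in> W" "y \<in> W" "z \<in> W" "w \<in> W"
    and dist: "x \<noteq> z" "x \<noteq> y" "y \<noteq> z" "w \<noteq> y"
    and edges: "{x, y} \<in> E" "{y, z} \<in> E" "{y, w} \<notin> E"
  shows "{x, z} \<in> E"
proof (rule ccontr)
  assume "{x, z} \<notin> E"
  then have "paired (insert {x, z} E) W" using sat mem dist by blast
  from paired_uses_edge[OF this no] obtain f where
    f: "\<And>v. v \<in> W \<Longrightarrow> f v \<in> W \<and> f (f v) = v \<and> f v \<noteq> v \<and> {v, f v} \<in> insert {x, z} E"
    and fx: "f x = z" by blast
  have "paired (insert {y, w} E) W" using sat mem dist edges by metis
  from paired_uses_edge[OF this no] obtain g where
    g: "\<And>v. v \<in> W \<Longrightarrow> g v \<in> W \<and> g (g v) = v \<and> g v \<noteq> v \<and> {v, g v} \<in> insert {y, w} E"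
    and gy: "g y = w" by blast
  have "paired E W"
    by (rule alternating_exchange[OF fin f g mem dist fx gy edges(1,2)])
  then show False using no by simp
qed

lemma exists_saturated:
  assumes "finite W" "\<not> paired E W"
  obtains E' where "E \<subseteq> E'" "\<not> paired E' W"
    "\<And>x z. x \<in> W \<Longrightarrow> z \<in> W \<Longrightarrow> {x, z} \<notin> E' \<Longrightarrow> paired (insert {x, z} E') W"
proof -
  \<comment> \<open>Only subsets of \<open>W\<close> are added, which keeps the family finite even
    if \<open>E\<close> is infinite.\<close>
  define A where "A = {D. D \<subseteq> Pow W \<and> \<not> paired (E \<union> D) W}"
  have "finite A" unfolding A_def using assms(1) by (auto intro: rev_finite_subset[of "Pow (Pow W)"])
  moreover have "{} \<in> A" using assms(2) A_def by auto
  ultimately obtain D where D: "D \<in> A" and Dmax: "\<forall>D'\<in>A. D \<subseteq> D' \<longrightarrow> D = D'"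
    using finite_has_maximal[of A] by (metis empty_iff)
  show thesis
  proof
    show "E \<subseteq> E \<union> D" by blast
    show "\<not> paired (E \<union> D) W" using D A_def by blast
    fix x z assume xz: "x \<in> W" "z \<in> W" "{x, z} \<notin> E \<union> D"
    show "paired (insert {x, z} (E \<union> D)) W"
    proof (rule ccontr)
      assume "\<not> ?thesis"
      then have "insert {x, z} D \<in> A" using D xz unfolding A_def by auto
      then have "D = insert {x, z} D" using Dmax by blast
      then show False using xz(3) by blast
    qed
  qed
qed

text \<open>In an edge-maximal supergraph, \<open>T\<close> is the set of vertices adjacent to all
  others, and adjacency is transitive outside \<open>T\<close>. Its classes are cliques, so the
  vertices of an independent set lie in different classes. In the original graph a class is a union
  of components of the graph without \<open>T\<close>.\<close>

lemma unpaired_classes: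
  assumes fin: "finite W" and "even (card W)" and "\<not> paired E W"
  obtains T R where "T \<subseteq> W" "equiv (W - T) R" "card T + 2 \<le> card ((W - T) // R)"
    "\<And>u v. u \<in> W - T \<Longrightarrow> v \<in> W - T \<Longrightarrow> {u, v} \<in> E \<Longrightarrow> (u, v) \<in> R"
proof -
  obtain E' where E': "E \<subseteq> E'" and no: "\<not> paired E' W"
    and sat: "\<And>x z. x \<in> W \<Longrightarrow> z \<in> W \<Longrightarrow> {x, z} \<notin> E' \<Longrightarrow> paired (insert {x, z} E') W"
    using exists_saturated[OF fin assms(3)] by blast
  define T where "T = {v \<in> W. \<forall>w\<in>W. v \<noteq> w \<longrightarrow> {v, w} \<in> E'}"
  define R where "R = {(u, v). u \<in> W - T \<and> v \<in> W - T \<and> (u = v \<or> {u, v} \<in> E')}"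
  have TW: "T \<subseteq> W" using T_def by blast
  have "trans R"
  proof (rule transI)
    fix x y z assume xy: "(x, y) \<in> R" and yz: "(y, z) \<in> R"
    then have m: "x \<in> W - T" "y \<in> W - T" "z \<in> W - T" by (auto simp: R_def)
    show "(x, z) \<in> R"
    proof (cases "x = z \<or> x = y \<or> y = z")
      case True
      then show ?thesis using xy yz m by (auto simp: R_def)
    next
      case False
      obtain w where "w \<in> W" "w \<noteq> y" "{y, w} \<notin> E'" using m(2) unfolding T_def by auto
      then have "{x, z} \<in> E'"
        using m xy yz False
        by (intro saturated_transitive[OF fin no sat, of x y z w]) (auto simp: R_def)
      then show ?thesis using m by (auto simp: R_def)
    qed
  qed
  then have eq: "equiv (W - T) R"
    by (intro equivI refl_onI symI) (auto simp: R_def insert_commute)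
  obtain I where I: "I \<subseteq> W - T" "card T + 2 \<le> card I"
    and indep: "\<forall>u\<in>I. \<forall>v\<in>I. u \<noteq> v \<longrightarrow> {u, v} \<notin> E'"
    using unpaired_independent_set[OF fin assms(2) no TW] unfolding T_def by blast
  have "inj_on (\<lambda>u. R `` {u}) I"
  proof (rule inj_onI)
    fix u v assume uv: "u \<in> I" "v \<in> I" "R `` {u} = R `` {v}"
    then have "(u, v) \<in> R" using I(1) by (intro eq_equiv_class[OF _ eq]) auto
    then show "u = v" using indep uv by (auto simp: R_def)
  qed
  then have "card I = card ((\<lambda>u. R `` {u}) ` I)" by (simp add: card_image)
  also have "\<dots> \<le> card ((W - T) // R)"
    using I(1) fin equiv_type[OF eq] by (intro card_mono finite_quotient quotientI image_subsetI) auto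
  finally show thesis
    using that[OF TW eq] I(2) E' by (auto simp: R_def)
qed

text \<open>\<open>U\<close> stands for the vertices covered by a matching of size \<open>k\<close>;
  a pairing of the remaining vertices completes it to a perfect matching.\<close>

lemma k_extendableI:
  assumes G: "simple_graph G" and card: "2 * k + 2 \<le> card (verts G)"
    and pm: "\<And>U. U \<subseteq> verts G \<Longrightarrow> card U = 2 * k \<Longrightarrow> paired (edges G) (verts G - U)"
  shows "k_extendable k G"
proof -
  have finV: "finite (verts G)" and e: "\<And>e. e \<in> edges G \<Longrightarrow> e \<subseteq> verts G \<and> card e = 2"
    using G unfolding simple_graph_def by auto
  have cardM: "card (\<Union>M) = 2 * card M" "\<Union>M \<subseteq> verts G" "finite M" if "matching G M" for M
  proof -
    have M: "M \<subseteq> edges G" "disjoint M" using that unfolding matching_def by auto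
    then show sub: "\<Union>M \<subseteq> verts G" using e by blast
    show fM: "finite M" using sub finV by (metis finite_UnionD finite_subset)
    have "card (\<Union>M) = sum card M"
    proof (rule card_Union_disjoint)
      show "pairwise disjnt M" using M(2) by (auto simp: disjoint_def pairwise_def disjnt_def)
      show "finite e" if "e \<in> M" for e using M(1) e finV that by (meson finite_subset subsetD)
    qed
    also have "\<dots> = 2 * card M" using M e by (simp add: subset_iff)
    finally show "card (\<Union>M) = 2 * card M" .
  qed
  have extend: "\<exists>M'. perfect_matching G M' \<and> M \<subseteq> M'" if M: "matching G M" "card M = k" for M
  proof -
    from pm[of "\<Union>M"] cardM[OF M(1)] M(2) obtain f where
      f: "\<And>v. v \<in> verts G - \<Union>M \<Longrightarrow>
        f v \<in> verts G - \<Union>M \<and> f (f v) = v \<and> f v \<noteq> v \<and> {v, f v} \<in> edges G"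
      unfolding paired_def by metis
    define N where "N = (\<lambda>v. {v, f v}) ` (verts G - \<Union>M)"
    have "disjoint N"
    proof (rule disjointI)
      fix a b assume "a \<in> N" "b \<in> N" "a \<noteq> b"
      then obtain u v where u: "u \<in> verts G - \<Union>M" "a = {u, f u}"
        and v: "v \<in> verts G - \<Union>M" "b = {v, f v}" unfolding N_def by blast
      have ffu: "f (f u) = u" and ffv: "f (f v) = v" using f u v by blast+
      have "u \<noteq> v" using \<open>a \<noteq> b\<close> u v by blast
      moreover from this have "f u \<noteq> f v" using ffu ffv by metis
      moreover have "u \<noteq> f v"
      proof
        assume "u = f v"
        then have "{u, f u} = {v, f v}" using ffv by auto
        then show False using \<open>a \<noteq> b\<close> u v by simp
      qed
      moreover from this have "f u \<noteq> v" using ffu by metis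
      ultimately have "u \<noteq> v" "f u \<noteq> f v" "u \<noteq> f v" "f u \<noteq> v" by simp_all
      then show "a \<inter> b = {}" using u v by auto
    qed
    moreover have U: "\<Union>N = verts G - \<Union>M" using f unfolding N_def by auto
    ultimately have "disjoint (M \<union> N)"
      using M(1) unfolding matching_def by (intro disjoint_union) auto
    moreover have "N \<subseteq> edges G" using f unfolding N_def by auto
    moreover have "\<Union>(M \<union> N) = verts G" using U cardM(2)[OF M(1)] by auto
    ultimately have "perfect_matching G (M \<union> N)"
      using M(1) unfolding perfect_matching_def matching_def by auto
    then show ?thesis by blast
  qed
  \<comment> \<open>A perfect matching will arise by extending some matching of size
    \<open>k\<close>. That one is built greedily: the covered vertices are enlarged to a set
    \<open>U\<close> of size \<open>2 * k\<close>, and an edge of a pairing outside \<open>U\<close>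
    is added.\<close>
  have "\<exists>M. matching G M \<and> card M = j" if "j \<le> k" for j
    using that
  proof (induction j)
    case 0
    have "matching G {}" by (simp add: matching_def disjoint_def)
    then show ?case by (metis card.empty)
  next
    case (Suc j)
    then obtain M where M: "matching G M" "card M = j" by auto
    have "2 * j \<le> 2 * k" "2 * k \<le> card (verts G)" using Suc.prems card by auto
    then obtain U where U: "\<Union>M \<subseteq> U" "U \<subseteq> verts G" "card U = 2 * k"
      using exists_subset_between[of "\<Union>M" "2 * k" "verts G"] cardM[OF M(1)] M(2) finV by auto
    have "\<not> verts G \<subseteq> U" using U card finite_subset[OF U(2) finV] card_mono[of U "verts G"] by auto
    then obtain v where v: "v \<in> verts G - U" by blast
    then obtain w where w: "w \<in> verts G - U" "{v, w} \<in> edges G"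
      using pm[OF U(2,3)] unfolding paired_def by blast
    have "{v, w} \<inter> \<Union>M = {}" using v w U(1) by blast
    then have "matching G (insert {v, w} M)" "{v, w} \<notin> M"
      using M(1) w(2) unfolding matching_def disjoint_def by auto
    then show ?case using M(2) cardM(3)[OF M(1)] by (intro exI[of _ "insert {v, w} M"]) auto
  qed
  then obtain M where "matching G M" "card M = k" by blast
  with extend show ?thesis unfolding k_extendable_def using card by blast
qed

section \<open>Eigenvalues of graphs\<close>

lemma eigenvalue_iff_sum:
  fixes A :: "'a :: field mat"
  assumes A: "A \<in> carrier_mat n n"
  shows "eigenvalue A l \<longleftrightarrow>
    (\<exists>x. (\<exists>i<n. x i \<noteq> 0) \<and> (\<forall>i<n. (\<Sum>j<n. A $$ (i, j) * x j) = l * x i))"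
proof
  assume "eigenvalue A l"
  then obtain v where v: "v \<in> carrier_vec n" "v \<noteq> 0\<^sub>v n" "A *\<^sub>v v = l \<cdot>\<^sub>v v"
    using A unfolding eigenvalue_def eigenvector_def by auto
  have "\<exists>i<n. v $ i \<noteq> 0"
  proof (rule ccontr)
    assume "\<not> ?thesis"
    then have "v = 0\<^sub>v n" using v(1) by (intro eq_vecI) auto
    then show False using v(2) by simp
  qed
  moreover have "(\<Sum>j<n. A $$ (i, j) * v $ j) = l * v $ i" if "i < n" for i
  proof -
    have "(A *\<^sub>v v) $ i = (l \<cdot>\<^sub>v v) $ i" using v(3) by simp
    then show ?thesis using that A v(1) by (simp add: scalar_prod_def atLeast0LessThan)
  qed
  ultimately show "\<exists>x. (\<exists>i<n. x i \<noteq> 0) \<and> (\<forall>i<n. (\<Sum>j<n. A $$ (i, j) * x j) = l * x i)"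
    by blast
next
  assume "\<exists>x. (\<exists>i<n. x i \<noteq> 0) \<and> (\<forall>i<n. (\<Sum>j<n. A $$ (i, j) * x j) = l * x i)"
  then obtain x k where x: "k < n" "x k \<noteq> 0"
    "\<And>i. i < n \<Longrightarrow> (\<Sum>j<n. A $$ (i, j) * x j) = l * x i" by blast
  have "vec n x \<noteq> 0\<^sub>v n"
  proof
    assume "vec n x = 0\<^sub>v n"
    then have "vec n x $ k = 0\<^sub>v n $ k" by simp
    then show False using x by simp
  qed
  moreover have "A *\<^sub>v vec n x = l \<cdot>\<^sub>v vec n x"
    using A x(3) by (intro eq_vecI) (auto simp: scalar_prod_def atLeast0LessThan)
  ultimately show "eigenvalue A l"
    using A unfolding eigenvalue_def eigenvector_def by (intro exI[of _ "vec n x"]) auto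
qed

text \<open>A complex eigenvalue \<open>l\<close> exists. The Hermitian form \<open>q\<close> of its
  eigenvector equals its own conjugate, so \<open>l\<close> is real, and the real or the imaginary
  part of the eigenvector is a real eigenvector. This makes the maximum in \<open>graph_rho\<close>
  attained.\<close>

lemma symmetric_spectrum_nonempty:
  fixes A :: "real mat"
  assumes A: "A \<in> carrier_mat n n" and n: "n > 0"
    and sym: "\<And>i j. i < n \<Longrightarrow> j < n \<Longrightarrow> A $$ (i, j) = A $$ (j, i)"
  shows "spectrum A \<noteq> {}"
proof -
  define B where "B = map_mat complex_of_real A"
  have B: "B \<in> carrier_mat n n" using A B_def by simp
  then obtain l where "eigenvalue B l" using spectrum_non_empty[OF B] n unfolding spectrum_def by auto
  then obtain z k where zk: "k < n" "z k \<noteq> 0"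
    and zB: "\<And>i. i < n \<Longrightarrow> (\<Sum>j<n. B $$ (i, j) * z j) = l * z i"
    unfolding eigenvalue_iff_sum[OF B] by blast
  have z: "(\<Sum>j<n. complex_of_real (A $$ (i, j)) * z j) = l * z i" if "i < n" for i
    using zB[OF that] that A by (simp add: B_def)
  define D where "D = (\<Sum>i<n. (cmod (z i))\<^sup>2)"
  define q where "q = (\<Sum>i<n. cnj (z i) * (\<Sum>j<n. complex_of_real (A $$ (i, j)) * z j))"
  have "(cmod (z k))\<^sup>2 \<le> D" unfolding D_def using zk(1) by (intro member_le_sum) auto
  then have D: "D \<noteq> 0" using zk(2) by auto
  have "q = l * of_real D"
    unfolding q_def D_def using z
    by (simp add: sum_distrib_left complex_norm_square[symmetric] mult_ac)
  moreover have "cnj q = q"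
  proof -
    have "cnj q = (\<Sum>i<n. \<Sum>j<n. z i * (complex_of_real (A $$ (i, j)) * cnj (z j)))"
      unfolding q_def by (simp add: sum_distrib_left)
    also have "\<dots> = (\<Sum>j<n. \<Sum>i<n. z i * (complex_of_real (A $$ (i, j)) * cnj (z j)))"
      by (rule sum.swap)
    also have "\<dots> = q" unfolding q_def using sym
      by (intro sum.cong refl) (auto simp: sum_distrib_left mult_ac intro!: sum.cong)
    finally show ?thesis .
  qed
  ultimately have "cnj l = l" using D by simp
  then have l: "Im l = 0" by (simp add: complex_eq_iff)
  have Re: "(\<Sum>j<n. A $$ (i, j) * Re (z j)) = Re l * Re (z i)"
    and Im: "(\<Sum>j<n. A $$ (i, j) * Im (z j)) = Re l * Im (z i)" if "i < n" for i
    using arg_cong[OF z[OF that], of Re] arg_cong[OF z[OF that], of Im] l by simp_all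
  have "Re (z k) \<noteq> 0 \<or> Im (z k) \<noteq> 0" using zk(2) by (simp add: complex_eq_iff)
  then have "eigenvalue A (Re l)"
  proof
    assume "Re (z k) \<noteq> 0"
    then show ?thesis unfolding eigenvalue_iff_sum[OF A]
      using Re zk(1) by (intro exI[of _ "\<lambda>i. Re (z i)"]) auto
  next
    assume "Im (z k) \<noteq> 0"
    then show ?thesis unfolding eigenvalue_iff_sum[OF A]
      using Im zk(1) by (intro exI[of _ "\<lambda>i. Im (z i)"]) auto
  qed
  then show ?thesis unfolding spectrum_def by auto
qed

text \<open>The eigenvalue equation over vertices, free of the enumeration in
  \<open>adjacency_matrix\<close>.\<close>

definition graph_eigenvalue :: "'a ugraph \<Rightarrow> real \<Rightarrow> bool" where
  "graph_eigenvalue G l \<longleftrightarrow> (\<exists>x. (\<exists>v\<in>verts G. x v \<noteq> 0) \<and>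
     (\<forall>v\<in>verts G. (\<Sum>w\<in>{w \<in> verts G. {v, w} \<in> edges G}. x w) = l * x v))"

lemma spectrum_adjacency_matrix:
  assumes fin: "finite (verts G)"
  shows "spectrum (adjacency_matrix G) = Collect (graph_eigenvalue G)"
proof -
  let ?V = "verts G" and ?n = "card (verts G)" and ?e = "from_nat_into (verts G)"
  let ?A = "adjacency_matrix G"
  have A: "?A \<in> carrier_mat ?n ?n" unfolding adjacency_matrix_def by simp
  have e: "bij_betw ?e {..<?n} ?V" using fin by (rule bij_betw_from_nat_into_finite)
  then have e': "?e ` {..<?n} = ?V" "inj_on ?e {..<?n}" by (auto simp: bij_betw_def)
  have row: "(\<Sum>j<?n. ?A $$ (i, j) * x (?e j)) = (\<Sum>w\<in>{w \<in> ?V. {?e i, w} \<in> edges G}. x w)"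
    if "i < ?n" for i and x :: "_ \<Rightarrow> real"
  proof -
    have "(\<Sum>j<?n. ?A $$ (i, j) * x (?e j)) =
        (\<Sum>j<?n. (if {?e i, ?e j} \<in> edges G then x (?e j) else 0))"
      using that unfolding adjacency_matrix_def by (intro sum.cong) auto
    also have "\<dots> = (\<Sum>w\<in>?V. (if {?e i, w} \<in> edges G then x w else 0))"
      by (rule sum.reindex_bij_betw[OF e])
    also have "\<dots> = (\<Sum>w\<in>{w \<in> ?V. {?e i, w} \<in> edges G}. x w)"
      using fin by (simp add: sum.inter_filter)
    finally show ?thesis .
  qed
  have "eigenvalue ?A l \<longleftrightarrow> graph_eigenvalue G l" for l
  proof
    assume "eigenvalue ?A l"
    then obtain x k where x: "k < ?n" "x k \<noteq> 0"
      "\<And>i. i < ?n \<Longrightarrow> (\<Sum>j<?n. ?A $$ (i, j) * x j) = l * x i"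
      unfolding eigenvalue_iff_sum[OF A] by blast
    define y where "y v = x (inv_into {..<?n} ?e v)" for v
    have y: "y (?e i) = x i" if "i < ?n" for i
      unfolding y_def using e'(2) that by (simp add: inv_into_f_f)
    show "graph_eigenvalue G l" unfolding graph_eigenvalue_def
    proof (intro exI[of _ y] conjI ballI)
      show "\<exists>v\<in>?V. y v \<noteq> 0" using x(1,2) y[OF x(1)] e' by (metis image_eqI lessThan_iff)
      fix v assume "v \<in> ?V"
      then obtain i where i: "i < ?n" "v = ?e i" using e'(1) by (metis imageE lessThan_iff)
      have "(\<Sum>w\<in>{w \<in> ?V. {v, w} \<in> edges G}. y w) = (\<Sum>j<?n. ?A $$ (i, j) * y (?e j))"
        using row[OF i(1)] i(2) by simp
      also have "\<dots> = (\<Sum>j<?n. ?A $$ (i, j) * x j)" using y by simp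
      finally show "(\<Sum>w\<in>{w \<in> ?V. {v, w} \<in> edges G}. y w) = l * y v" using x(3) i y by simp
    qed
  next
    assume "graph_eigenvalue G l"
    then obtain x v where x: "v \<in> ?V" "x v \<noteq> 0"
      "\<And>v. v \<in> ?V \<Longrightarrow> (\<Sum>w\<in>{w \<in> ?V. {v, w} \<in> edges G}. x w) = l * x v"
      unfolding graph_eigenvalue_def by blast
    obtain k where "k < ?n" "v = ?e k" using e'(1) x(1) by (metis imageE lessThan_iff)
    moreover have "?e i \<in> ?V" if "i < ?n" for i using e'(1) that by blast
    ultimately show "eigenvalue ?A l"
      unfolding eigenvalue_iff_sum[OF A] using x row
      by (intro exI[of _ "\<lambda>i. x (?e i)"]) auto
  qed
  then show ?thesis unfolding spectrum_def by auto
qed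

lemma graph_rho_ge:
  assumes "finite (verts G)" "graph_eigenvalue G l"
  shows "l \<le> graph_rho G"
proof -
  have "adjacency_matrix G \<in> carrier_mat (card (verts G)) (card (verts G))"
    unfolding adjacency_matrix_def by simp
  then have "finite (spectrum (adjacency_matrix G))" by (rule card_finite_spectrum)
  then show ?thesis unfolding graph_rho_def using assms
    by (intro Max_ge) (auto simp: spectrum_adjacency_matrix)
qed

lemma graph_eigenvalue_rho:
  assumes "finite (verts G)" "verts G \<noteq> {}"
  shows "graph_eigenvalue G (graph_rho G)"
proof -
  let ?n = "card (verts G)"
  have A: "adjacency_matrix G \<in> carrier_mat ?n ?n" unfolding adjacency_matrix_def by simp
  have "spectrum (adjacency_matrix G) \<noteq> {}" using assms
    by (intro symmetric_spectrum_nonempty[OF A]) (auto simp: adjacency_matrix_def insert_commute card_gt_0_iff)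
  then have "graph_rho G \<in> spectrum (adjacency_matrix G)"
    unfolding graph_rho_def using card_finite_spectrum(1)[OF A] by (rule Max_in[rotated])
  then show ?thesis using assms by (simp add: spectrum_adjacency_matrix)
qed

text \<open>A positive vector \<open>z\<close> with \<open>A z \<le> l z\<close> bounds all eigenvalues by \<open>l\<close>.  If \<open>l\<close> is attained, a
  vertex maximising \<open>\<bar>x v\<bar> / z v\<close> for an eigenvector \<open>x\<close> satisfies its inequality with equality and
  passes the maximality on to its neighbours.\<close>

lemma certificate_tight:
  fixes z :: "'a \<Rightarrow> real"
  assumes fin: "finite (verts G)" and conn: "graph_connected G"
    and edges: "\<And>e. e \<in> edges G \<Longrightarrow> e \<subseteq> verts G"
    and ev: "graph_eigenvalue G m" and m: "l \<le> m" "0 \<le> l"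
    and z: "\<And>v. v \<in> verts G \<Longrightarrow> z v > 0"
    and Az: "\<And>v. v \<in> verts G \<Longrightarrow> (\<Sum>w\<in>{w \<in> verts G. {v, w} \<in> edges G}. z w) \<le> l * z v"
    and v: "v \<in> verts G"
  shows "(\<Sum>w\<in>{w \<in> verts G. {v, w} \<in> edges G}. z w) = l * z v"
proof -
  let ?V = "verts G" and ?N = "\<lambda>v. {w \<in> verts G. {v, w} \<in> edges G}"
  obtain x u0 where x0: "u0 \<in> ?V" "x u0 \<noteq> 0"
    and x: "\<And>v. v \<in> ?V \<Longrightarrow> (\<Sum>w\<in>?N v. x w) = m * x v"
    using ev unfolding graph_eigenvalue_def by blast
  define c where "c = Max ((\<lambda>v. \<bar>x v\<bar> / z v) ` ?V)"
  have le: "\<bar>x v\<bar> \<le> c * z v" if "v \<in> ?V" for v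
  proof -
    have "\<bar>x v\<bar> / z v \<le> c" unfolding c_def using fin that by (intro Max_ge) auto
    then show ?thesis using z[OF that] by (simp add: divide_le_eq)
  qed
  have "c \<in> (\<lambda>v. \<bar>x v\<bar> / z v) ` ?V" unfolding c_def using fin x0 by (intro Max_in) auto
  then obtain u where u: "u \<in> ?V" "\<bar>x u\<bar> = c * z u" using z by fastforce
  have c: "c > 0"
  proof -
    have "0 < c * z u0" using le[OF x0(1)] x0(2) by linarith
    then show ?thesis using z[OF x0(1)] by (simp add: zero_less_mult_iff)
  qed
  have adj: "(\<Sum>w\<in>?N v. z w) = l * z v \<and> (\<forall>w\<in>?N v. \<bar>x w\<bar> = c * z w)"
    if v: "v \<in> ?V" "\<bar>x v\<bar> = c * z v" for v
  proof -
    \<comment> \<open>Facts \<open>1\<close>, \<open>2\<close> and \<open>3\<close> form a chain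
      from \<open>l * (c * z v)\<close> back to itself, so each of them is an equality.\<close>
    have "l * (c * z v) \<le> m * \<bar>x v\<bar>" using v m z[OF v(1)] c by (intro mult_mono) auto
    also have "\<dots> = \<bar>\<Sum>w\<in>?N v. x w\<bar>" using x[OF v(1)] m by (simp add: abs_mult)
    also have "\<dots> \<le> (\<Sum>w\<in>?N v. \<bar>x w\<bar>)" by (rule sum_abs)
    finally have 1: "l * (c * z v) \<le> (\<Sum>w\<in>?N v. \<bar>x w\<bar>)" .
    have 2: "(\<Sum>w\<in>?N v. \<bar>x w\<bar>) \<le> (\<Sum>w\<in>?N v. c * z w)" using le by (intro sum_mono) auto
    have 3: "(\<Sum>w\<in>?N v. c * z w) \<le> c * (l * z v)"
      using Az[OF v(1)] c by (simp add: sum_distrib_left[symmetric])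
    have "(\<Sum>w\<in>?N v. c * z w) = c * (l * z v)" using 1 2 3 by (simp add: mult_ac)
    then have "(\<Sum>w\<in>?N v. z w) = l * z v" using c by (simp add: sum_distrib_left[symmetric])
    moreover have "(\<Sum>w\<in>?N v. c * z w - \<bar>x w\<bar>) = 0" using 1 2 3 by (simp add: sum_subtractf mult_ac)
    then have "\<forall>w\<in>?N v. c * z w - \<bar>x w\<bar> = 0"
      using fin le by (subst (asm) sum_nonneg_eq_0_iff) auto
    ultimately show ?thesis by auto
  qed
  have "(u, v) \<in> {(x, y). {x, y} \<in> edges G}\<^sup>*" using conn u(1) v unfolding graph_connected_def by blast
  then have "v \<in> ?V \<and> \<bar>x v\<bar> = c * z v"
  proof (induction rule: rtrancl_induct)
    case base
    then show ?case using u by simp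
  next
    case (step a b)
    then have "b \<in> ?N a" using edges[of "{a, b}"] by auto
    then show ?case using adj step.IH by blast
  qed
  then show ?thesis using adj by blast
qed

section \<open>The extremal graph\<close>

lemma union_edges [simp]:
  "{Inl a, Inl b} \<in> edges (graph_union G H) \<longleftrightarrow> {a, b} \<in> edges G"
  "{Inr c, Inr d} \<in> edges (graph_union G H) \<longleftrightarrow> {c, d} \<in> edges H"
  "{Inl a, Inr d} \<notin> edges (graph_union G H)"
  "{Inr c, Inl b} \<notin> edges (graph_union G H)"
proof -
  have l: "Inl ` e = {Inl a, Inl b} \<longleftrightarrow> e = {a, b}" for e and a b :: 'a
    using inj_image_eq_iff[OF inj_Inl, of e "{a, b}"] by simp
  have r: "Inr ` e = {Inr a, Inr b} \<longleftrightarrow> e = {a, b}" for e and a b :: 'b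
    using inj_image_eq_iff[OF inj_Inr, of e "{a, b}"] by simp
  show "{Inl a, Inl b} \<in> edges (graph_union G H) \<longleftrightarrow> {a, b} \<in> edges G"
    unfolding graph_union_def by (auto simp: l image_iff eq_commute[of "{Inl a, Inl b}"])
  show "{Inr c, Inr d} \<in> edges (graph_union G H) \<longleftrightarrow> {c, d} \<in> edges H"
    unfolding graph_union_def by (auto simp: r image_iff eq_commute[of "{Inr c, Inr d}"])
  show "{Inl a, Inr d} \<notin> edges (graph_union G H)" "{Inr c, Inl b} \<notin> edges (graph_union G H)"
    unfolding graph_union_def by auto
qed

lemma join_edges [simp]:
  "{Inl a, Inl b} \<in> edges (graph_join G H) \<longleftrightarrow> {a, b} \<in> edges G"
  "{Inr c, Inr d} \<in> edges (graph_join G H) \<longleftrightarrow> {c, d} \<in> edges H"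
  "{Inl a, Inr d} \<in> edges (graph_join G H) \<longleftrightarrow> a \<in> verts G \<and> d \<in> verts H"
  "{Inr c, Inl b} \<in> edges (graph_join G H) \<longleftrightarrow> b \<in> verts G \<and> c \<in> verts H"
  unfolding graph_join_def by (auto simp: doubleton_eq_iff)

lemma verts_simps [simp]:
  "verts (graph_union G H) = verts G <+> verts H"
  "verts (graph_join G H) = verts G <+> verts H"
  "verts (complete_graph r) = {..<r}"
  by (simp_all add: graph_union_def graph_join_def complete_graph_def)

lemma complete_edges [simp]:
  "{u, v} \<in> edges (complete_graph r) \<longleftrightarrow> u < r \<and> v < r \<and> u \<noteq> v"
  unfolding complete_graph_def by (auto simp: doubleton_eq_iff)

lemma in_Plus_iff [simp]:
  "Inl a \<in> A <+> B \<longleftrightarrow> a \<in> A" "Inr b \<in> A <+> B \<longleftrightarrow> b \<in> B"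
  by auto

abbreviation extremal :: "nat \<Rightarrow> nat \<Rightarrow> (nat + nat + nat) ugraph" where
  "extremal a b \<equiv> graph_join (complete_graph a) (graph_union (complete_graph b) (complete_graph 1))"

text \<open>Loops are treated separately because \<open>{v, v}\<close> simplifies to
  \<open>{v}\<close>, which the rules for edges do not match.\<close>

lemma extremal_no_loop: "{v} \<notin> edges (extremal a b)"
proof -
  have "{v, v} \<notin> edges (extremal a b)"
    by (cases v; (cases "projr v")?) (simp_all del: insert_absorb2)
  then show ?thesis by simp
qed

text \<open>The eigenvector is constant on each of the three complete graphs. The values on the last
  two are chosen to satisfy their own rows; \<open>eq\<close> is the row of a vertex of the
  first.\<close>

lemma extremal_eigenvalue:
  fixes \<mu> :: real
  assumes mu: "\<mu> > 1" "\<mu> > real b"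
    and eq: "real a + real b * (real a / (\<mu> - real b)) + real a / (\<mu> - 1) = \<mu>"
    and a: "a > 0"
  shows "graph_eigenvalue (extremal a b) (\<mu> - 1)"
proof -
  define x where "x = case_sum (\<lambda>_::nat. 1)
    (case_sum (\<lambda>_::nat. real a / (\<mu> - real b)) (\<lambda>_::nat. real a / (\<mu> - 1)))"
  let ?F = "extremal a b"
  have split: "(\<Sum>w\<in>{w \<in> verts ?F. {v, w} \<in> edges ?F}. x w) =
    (\<Sum>i<a. if {v, Inl i} \<in> edges ?F then 1 else 0) +
    (\<Sum>i<b. if {v, Inr (Inl i)} \<in> edges ?F then real a / (\<mu> - real b) else 0) +
    (if {v, Inr (Inr 0)} \<in> edges ?F then real a / (\<mu> - 1) else 0)" for v
  proof -
    have "(\<Sum>w\<in>{w \<in> verts ?F. {v, w} \<in> edges ?F}. x w) =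
        (\<Sum>w\<in>verts ?F. if {v, w} \<in> edges ?F then x w else 0)"
      by (rule sum.inter_filter) auto
    then show ?thesis by (simp add: sum.Plus x_def cong: if_cong)
  qed
  have card: "(\<Sum>j<r. if i \<noteq> j then c else 0) = (real r - 1) * c" if "i < r" for i r :: nat and c :: real
  proof -
    have "(\<Sum>j<r. if i \<noteq> j then c else 0) = (\<Sum>j\<in>{..<r} - {i}. c)"
      by (rule sum.mono_neutral_cong_right) auto
    then show ?thesis using that by (simp add: of_nat_diff)
  qed
  have row: "(\<Sum>w\<in>{w \<in> verts ?F. {v, w} \<in> edges ?F}. x w) = (\<mu> - 1) * x v" if v: "v \<in> verts ?F" for v
  proof -
    consider i where "v = Inl i" "i < a" | i where "v = Inr (Inl i)" "i < b" | "v = Inr (Inr 0)"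
      using v by auto
    then show ?thesis
    proof cases
      case 1
      then show ?thesis unfolding split using eq card[of i a 1] by (simp add: x_def)
    next
      case 2
      have "real a + (real b - 1) * (real a / (\<mu> - real b)) = (\<mu> - 1) * (real a / (\<mu> - real b))"
        using mu by (simp add: field_simps)
      then show ?thesis unfolding split using 2 card[of i b "real a / (\<mu> - real b)"]
        by (simp add: x_def)
    next
      case 3
      then show ?thesis unfolding split using mu extremal_no_loop[of "Inr (Inr 0)" a b] by (simp add: x_def)
    qed
  qed
  moreover have "Inl 0 \<in> verts ?F" "x (Inl 0) \<noteq> 0" using a by (auto simp: x_def)
  ultimately show ?thesis unfolding graph_eigenvalue_def by blast
qed

lemma iso_extremalI:
  assumes V: "verts G = S \<union> C \<union> {v0}" and fin: "finite S" "finite C"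
    and disj: "S \<inter> C = {}" "v0 \<notin> S" "v0 \<notin> C"
    and E: "\<And>u v. u \<in> verts G \<Longrightarrow> v \<in> verts G \<Longrightarrow> {u, v} \<in> edges G \<longleftrightarrow>
      u \<noteq> v \<and> \<not> (u = v0 \<and> v \<in> C) \<and> \<not> (v = v0 \<and> u \<in> C)"
  shows "graph_iso G (extremal (card S) (card C))"
proof -
  obtain g h where g: "bij_betw g S {..<card S}" and h: "bij_betw h C {..<card C}"
    using fin ex_bij_betw_finite_nat by (metis atLeast0LessThan)
  define f where "f v = (if v \<in> S then Inl (g v) else if v \<in> C then Inr (Inl (h v)) else Inr (Inr (0::nat)))" for v
  have gS: "g v < card S" if "v \<in> S" for v using g that by (auto simp: bij_betw_def)
  have hC: "h v < card C" if "v \<in> C" for v using h that by (auto simp: bij_betw_def)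
  have gi: "g u = g v \<longleftrightarrow> u = v" if "u \<in> S" "v \<in> S" for u v
    using g that by (auto simp: bij_betw_def inj_on_def)
  have hi: "h u = h v \<longleftrightarrow> u = v" if "u \<in> C" "v \<in> C" for u v
    using h that by (auto simp: bij_betw_def inj_on_def)
  have "bij_betw f (verts G) (verts (extremal (card S) (card C)))"
  proof -
    have "inj_on f (verts G)"
      unfolding inj_on_def V f_def using disj gi hi by auto
    moreover have "f ` verts G = verts (extremal (card S) (card C))"
    proof -
      have "f ` S = Inl ` {..<card S}" using g unfolding f_def bij_betw_def by (auto simp: image_image[symmetric])
      moreover have "f ` C = Inr ` Inl ` {..<card C}"
      proof -
        have "f ` C = (\<lambda>v. Inr (Inl (h v))) ` C" using disj unfolding f_def by (intro image_cong) auto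
        also have "\<dots> = Inr ` Inl ` h ` C" by (simp add: image_image)
        finally show ?thesis using h unfolding bij_betw_def by simp
      qed
      moreover have "f v0 = Inr (Inr 0)" using disj unfolding f_def by auto
      ultimately show ?thesis unfolding V image_Un by (auto simp: Plus_def)
    qed
    ultimately show ?thesis by (simp add: bij_betw_def)
  qed
  moreover have "{u, v} \<in> edges G \<longleftrightarrow> {f u, f v} \<in> edges (extremal (card S) (card C))"
    if u: "u \<in> verts G" and v: "v \<in> verts G" for u v
  proof -
    have cu: "u \<in> S \<or> u \<in> C \<and> u \<notin> S \<or> u = v0 \<and> u \<notin> S \<and> u \<notin> C"
      and cv: "v \<in> S \<or> v \<in> C \<and> v \<notin> S \<or> v = v0 \<and> v \<notin> S \<and> v \<notin> C"
      using u v V disj by auto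
    have loop: "{Inr (Inr 0)} \<notin> edges (extremal (card S) (card C))" by (rule extremal_no_loop)
    from cu cv show ?thesis
      unfolding E[OF u v] f_def
      using disj gi[of u v] hi[of u v] gS[of u] gS[of v] hC[of u] hC[of v] loop
      by (elim disjE conjE) auto
  qed
  ultimately show ?thesis unfolding graph_iso_def by blast
qed

text \<open>Below, \<open>P = n - 2k - 1\<close> (odd, as \<open>n\<close> is even), and the cubic equation for \<open>\<mu>\<close> is the
  characteristic equation of the extremal graph, shifted by \<open>1\<close> and without denominators.  The next
  inequality is the case \<open>P = 3\<close>, where \<open>K\<^sub>n\<close> minus a star is compared with \<open>K\<^sub>n\<close> minus a triangle:
  the numbers of edges agree, so cruder estimates fail.\<close>

lemma star_triangle_ineq:
  fixes k d :: real
  assumes k: "k > 0" "d > 2 * k" "d < 2 * k + 1"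
    and eq: "(d + 3) * (d + 2) * (d - 2 * k) = 2 * k * d"
  shows "4 * k < (d + 2) * (d - 2 * k + 1)"
proof -
  define e where "e = d - 2 * k"
  have e: "e > 0" "d = 2 * k + e" using k e_def by auto
  \<comment> \<open>The claim multiplied by \<open>d + 3\<close>, with its cubic part replaced by
    means of \<open>eq\<close> and \<open>d\<close> written as \<open>2 * k + e\<close>.\<close>
  have "e^2 + (2 * k + 5) * e + 6 - 2 * k > 0"
  proof (cases "k \<le> 3")
    case True
    have "e^2 > 0" "(2 * k + 5) * e > 0" using e k by auto
    then show ?thesis using True by linarith
  next
    case False
    \<comment> \<open>Now the constant term is negative, and \<open>eq\<close> supplies a lower
      bound on \<open>e\<close> to outweigh it.\<close>
    have pos: "(d + 3) * (d + 2) > 0" using k by auto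
    have "(2 * k - 6) * (d * d) \<le> (2 * k - 6) * (d * (2 * k + 1))"
      using False k by (intro mult_left_mono) auto
    moreover have "k * d > 0" using k by simp
    then have "12 * k < 36 + 36 * d + 10 * (k * d)" using k by linarith
    ultimately have "(2 * k - 6) * ((d + 3) * (d + 2)) < (2 * k + 5) * (2 * k * d)"
      by (simp add: algebra_simps)
    also have "\<dots> = (2 * k + 5) * e * ((d + 3) * (d + 2))" 
      unfolding eq[symmetric] e_def by (simp only: mult_ac)
    finally have "2 * k - 6 < (2 * k + 5) * e" using pos by (simp add: mult_less_cancel_right)
    then show ?thesis using e by (smt (verit) zero_less_power)
  qed
  then have "d * (d - 2 * k) + 5 * d + 6 - 12 * k > 0"
    unfolding e(2) by (simp add: algebra_simps power2_eq_square)
  then have "4 * k * (d + 3) < (d + 2) * (d + 3) + 2 * k * d" by (simp add: algebra_simps)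
  also have "\<dots> = (d + 2) * (d - 2 * k + 1) * (d + 3)" using eq by (simp add: algebra_simps)
  finally show ?thesis using k by (simp add: mult_less_cancel_right)
qed

text \<open>The inequality at \<open>S\<close> in the worst case left by convexity: one class of
  order \<open>P - 2 * t\<close> and \<open>t + 1\<close> singletons. Cleared of denominators and
  multiplied by \<open>d\<close>, it is \<open>t\<close> times fact \<open>3\<close>, modulo the
  cubic equation.\<close>

lemma row_sum_strict:
  fixes k P t \<mu> :: real
  assumes k: "k > 0" and P: "P = 3 \<or> P \<ge> 5" and t: "t > 0" "2 * t + 1 \<le> P"
    and mu: "2 * k + P < \<mu>" "\<mu> < 2 * k + P + 1"
    and eq: "\<mu> * (\<mu> - 1) * (\<mu> - P - 2 * k) = 2 * k * (\<mu> - P)"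
  shows "(2 * k + t) * ((P - 2 * t) / (\<mu> - (P - 2 * t)) + (t + 1) / (\<mu> - 1)) < \<mu> - (2 * k + t)"
proof -
  define d where "d = \<mu> - P"
  have d: "d > 2 * k" "d < 2 * k + 1" "d > 0" "\<mu> > 1" "\<mu> = d + P" using mu k P by (auto simp: d_def)
  \<comment> \<open>The extreme case \<open>t = (P - 1) / 2\<close> of fact \<open>3\<close>,
    rewritten by the cubic equation. For \<open>P \<ge> 5\<close> the last factor is at least
    \<open>2\<close>, which suffices.\<close>
  have 1: "4 * k < (\<mu> - 1) * (d - 2 * k + (P - 1) / 2)"
    using P
  proof
    assume "P = 3"
    then show ?thesis using star_triangle_ineq[of k d] k d eq by (simp add: algebra_simps)
  next
    assume "P \<ge> 5"
    then have "2 \<le> d - 2 * k + (P - 1) / 2" using d(1) by (simp add: field_simps)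
    then have "(\<mu> - 1) * 2 \<le> (\<mu> - 1) * (d - 2 * k + (P - 1) / 2)"
      using d(4) by (intro mult_left_mono) auto
    moreover have "4 * k < (\<mu> - 1) * 2" using mu(1) \<open>P \<ge> 5\<close> by simp
    ultimately show ?thesis by (rule less_le_trans[rotated])
  qed
  have eq': "d * (\<mu> * (\<mu> - 1)) = 2 * k * (\<mu> * (\<mu> - 1)) + 2 * k * d"
    using eq by (simp add: d_def algebra_simps)
  have "(2 * k + t + 1) * (d + 2 * t) \<le> (2 * k + (P + 1) / 2) * (\<mu> - 1)"
    using t d k by (intro mult_mono) auto
  then have "(2 * k + t + 1) * (d + 2 * t) + 4 * k < \<mu> * (\<mu> - 1)"
    using 1 unfolding d(5) by (simp add: field_simps)
  then have "d * ((2 * k + t + 1) * (d + 2 * t) + 4 * k) < d * (\<mu> * (\<mu> - 1))"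
    using d(3) by (rule mult_strict_left_mono)
  also note eq'
  finally have 2: "(2 * k + t + 1) * (d + 2 * t) * d + 2 * k * d < 2 * k * (\<mu> * (\<mu> - 1))"
    by (simp add: algebra_simps)
  have 3: "(2 * k + t + 1) * (d + 2 * t) * d < (4 * k - d) * (\<mu> * (\<mu> - 1))"
    using 2 eq' by (simp add: algebra_simps)
  have "t * ((2 * k + t + 1) * (d + 2 * t) * d) < t * ((4 * k - d) * (\<mu> * (\<mu> - 1)))"
    using 3 t(1) by (rule mult_strict_left_mono)
  \<comment> \<open>The factor of \<open>d\<close> on the left is the numerator of the claim; the
    last summand on the right vanishes by \<open>eq'\<close>.\<close>
  moreover have "d * (((2 * k + t) * \<mu> - \<mu> * (d + 2 * t)) * (\<mu> - 1) + (2 * k + t) * (t + 1) * (d + 2 * t))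
     = t * ((2 * k + t + 1) * (d + 2 * t) * d) - t * ((4 * k - d) * (\<mu> * (\<mu> - 1)))
      + (d + 2 * t) * (2 * k * (\<mu> * (\<mu> - 1)) + 2 * k * d - d * (\<mu> * (\<mu> - 1)))"
    by (simp add: algebra_simps)
  ultimately have "d * (((2 * k + t) * \<mu> - \<mu> * (d + 2 * t)) * (\<mu> - 1) + (2 * k + t) * (t + 1) * (d + 2 * t)) < 0"
    using eq' by simp
  then have 4: "((2 * k + t) * \<mu> - \<mu> * (d + 2 * t)) * (\<mu> - 1) + (2 * k + t) * (t + 1) * (d + 2 * t) < 0"
    using d(3) by (simp add: mult_less_0_iff)
  have pos: "d + 2 * t > 0" "\<mu> - 1 > 0" using d t by auto
  have "A / x + B / y - c = ((A - c * x) * y + B * x) / (x * y)" if "x > 0" "y > 0"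
    for A B c x y :: real using that by (simp add: field_simps)
  from this[OF pos] have "(2 * k + t) * \<mu> / (d + 2 * t) + (2 * k + t) * (t + 1) / (\<mu> - 1) - \<mu> =
    (((2 * k + t) * \<mu> - \<mu> * (d + 2 * t)) * (\<mu> - 1) + (2 * k + t) * (t + 1) * (d + 2 * t)) / ((d + 2 * t) * (\<mu> - 1))" .
  also have "\<dots> < 0" using 4 pos by (simp add: divide_neg_pos)
  finally have 5: "(2 * k + t) * \<mu> / (d + 2 * t) + (2 * k + t) * (t + 1) / (\<mu> - 1) < \<mu>" by simp
  have m: "\<mu> - (P - 2 * t) = d + 2 * t" by (simp add: d_def)
  have p: "(P - 2 * t) / (d + 2 * t) = \<mu> / (d + 2 * t) - 1"
    using pos by (simp add: d_def field_simps)
  show ?thesis unfolding m p using 5 by (simp add: algebra_simps)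
qed

text \<open>The cubic changes sign on the interval. With \<open>n = 2 * k + 1 + P\<close>, the
  bounds place \<open>\<mu> - 1\<close> strictly between the spectral radii of the complete graphs
  on \<open>n - 1\<close> and \<open>n\<close> vertices.\<close>

lemma exists_mu:
  fixes k P :: real
  assumes "k > 0" "P \<ge> 1"
  obtains \<mu> where "2 * k + P < \<mu>" "\<mu> < 2 * k + P + 1"
    "\<mu> * (\<mu> - 1) * (\<mu> - P - 2 * k) = 2 * k * (\<mu> - P)"
proof -
  define h where "h x = x * (x - 1) * (x - P - 2 * k) - 2 * k * (x - P)" for x
  have cont: "continuous_on {2 * k + P..2 * k + P + 1} h"
    unfolding h_def by (intro continuous_intros)
  have lo: "h (2 * k + P) < 0" using assms unfolding h_def by simp
  have "(2 * k + 1) * (2 * k) < (2 * k + P + 1) * (2 * k + P)"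
    using assms by (intro mult_strict_mono) auto
  then have hi: "h (2 * k + P + 1) > 0" unfolding h_def by (simp add: algebra_simps)
  obtain x where "2 * k + P \<le> x" "x \<le> 2 * k + P + 1" "h x = 0"
    using IVT'[of h "2 * k + P" 0 "2 * k + P + 1"] lo hi cont by auto
  moreover from this have "x \<noteq> 2 * k + P" "x \<noteq> 2 * k + P + 1" using lo hi by auto
  ultimately show thesis using that[of x] unfolding h_def by auto
qed

section \<open>The spectral bound\<close>

lemma sum_eq_imp_set_eq:
  fixes z :: "'a \<Rightarrow> real"
  assumes "finite B" "A \<subseteq> B" "\<And>w. w \<in> B \<Longrightarrow> z w > 0" "sum z A = sum z B"
  shows "A = B"
proof -
  have "sum z (B - A) = 0" using assms by (simp add: sum_diff)
  then have "B - A = {}"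
    using assms by (subst (asm) sum_nonneg_eq_0_iff) (force intro: less_imp_le)+
  then show ?thesis using assms(2) by blast
qed

text \<open>By convexity \<open>x / (\<mu> - x)\<close> lies below its chord on \<open>[1, p]\<close>; the slope \<open>m\<close> of the chord exceeds
  the value at \<open>1\<close>, so additional summands only decrease the sum.\<close>

lemma sum_convex_bound:
  fixes c :: "'i \<Rightarrow> nat" and \<mu> :: real
  assumes fin: "finite Q" and pos: "\<forall>i\<in>Q. c i \<ge> 1"
    and card: "q + 1 \<le> card Q" and sum: "(\<Sum>i\<in>Q. c i) = p + q" and p: "p \<ge> 1"
    and mu: "real p < \<mu>" "\<mu> > 1"
  shows "(\<Sum>i\<in>Q. real (c i) / (\<mu> - real (c i))) \<le> real p / (\<mu> - real p) + real q / (\<mu> - 1)"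
    and "(\<Sum>i\<in>Q. real (c i) / (\<mu> - real (c i))) = real p / (\<mu> - real p) + real q / (\<mu> - 1) \<Longrightarrow>
      card Q = q + 1 \<and> (\<forall>i\<in>Q. c i = 1 \<or> c i = p)"
    and "\<And>i. i \<in> Q \<Longrightarrow> c i \<le> p"
proof -
  define g where "g x = x / (\<mu> - x)" for x :: real
  define m where "m = \<mu> / ((\<mu> - 1) * (\<mu> - real p))"
  \<comment> \<open>The other summands contribute at least \<open>card Q - 1 \<ge> q\<close> to the
    total \<open>p + q\<close>.\<close>
  have cp: "c i \<le> p" if i: "i \<in> Q" for i
  proof -
    have "card Q - 1 = (\<Sum>j\<in>Q - {i}. 1)" using fin i by simp
    also have "\<dots> \<le> (\<Sum>j\<in>Q - {i}. c j)" using pos by (intro sum_mono) auto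
    finally show ?thesis using sum card fin i by (simp add: sum.remove)
  qed
  then show "\<And>i. i \<in> Q \<Longrightarrow> c i \<le> p" .
  \<comment> \<open>The distance from the graph of \<open>g\<close> to its chord, factored so that
    its sign and its zeros \<open>1\<close> and \<open>p\<close> on \<open>[1, p]\<close> can be
    read off.\<close>
  have gap: "1 / (\<mu> - 1) + (x - 1) * m - g x = (x - 1) * (real p - x) * \<mu> / ((\<mu> - 1) * (\<mu> - real p) * (\<mu> - x))"
    if "x < \<mu>" for x
  proof -
    have ne: "\<mu> - 1 \<noteq> 0" "\<mu> - real p \<noteq> 0" "\<mu> - x \<noteq> 0" using mu that by auto
    have "1 / (\<mu> - 1) - g x = - ((x - 1) * \<mu> / ((\<mu> - 1) * (\<mu> - x)))"
    proof -
      have "1 / (\<mu> - 1) - g x = (1 * (\<mu> - x) - x * (\<mu> - 1)) / ((\<mu> - 1) * (\<mu> - x))"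
        unfolding g_def by (rule diff_frac_eq[OF ne(1,3)])
      also have "1 * (\<mu> - x) - x * (\<mu> - 1) = - ((x - 1) * \<mu>)" by (simp add: algebra_simps)
      finally show ?thesis by simp
    qed
    moreover have "(x - 1) * m - (x - 1) * \<mu> / ((\<mu> - 1) * (\<mu> - x)) =
      (x - 1) * (real p - x) * \<mu> / ((\<mu> - 1) * (\<mu> - real p) * (\<mu> - x))"
    proof -
      have "A / (B * C) - A / (B * D) = A * (D - C) / (B * C * D)"
        if "B \<noteq> 0" "C \<noteq> 0" "D \<noteq> 0" for A B C D :: real
        using that by (simp add: field_simps)
      from this[OF ne, of "(x - 1) * \<mu>"] show ?thesis unfolding m_def by (simp add: mult_ac)
    qed
    ultimately show ?thesis by simp
  qed
  have chord: "g (c i) \<le> 1 / (\<mu> - 1) + (real (c i) - 1) * m"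
    and tight: "g (c i) = 1 / (\<mu> - 1) + (real (c i) - 1) * m \<Longrightarrow> c i = 1 \<or> c i = p"
    if i: "i \<in> Q" for i
  proof -
    have lt: "real (c i) < \<mu>" using cp[OF i] mu by linarith
    have "(real (c i) - 1) * (real p - real (c i)) * \<mu> / ((\<mu> - 1) * (\<mu> - real p) * (\<mu> - real (c i))) \<ge> 0"
      using mu lt cp[OF i] pos i by (intro divide_nonneg_pos mult_nonneg_nonneg mult_pos_pos) auto
    then show "g (c i) \<le> 1 / (\<mu> - 1) + (real (c i) - 1) * m" using gap[OF lt] by linarith
    assume "g (c i) = 1 / (\<mu> - 1) + (real (c i) - 1) * m"
    then have "(real (c i) - 1) * (real p - real (c i)) * \<mu> / ((\<mu> - 1) * (\<mu> - real p) * (\<mu> - real (c i))) = 0"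
      using gap[OF lt] by linarith
    then show "c i = 1 \<or> c i = p" using mu lt by auto
  qed
  have slope: "m > 1 / (\<mu> - 1)"
  proof -
    have "1 / (\<mu> - 1) * 1 < 1 / (\<mu> - 1) * (\<mu> / (\<mu> - real p))"
      using mu p by (intro mult_strict_left_mono) auto
    then show ?thesis unfolding m_def by simp
  qed
  let ?r = "real (card Q)"
  have lin: "(\<Sum>i\<in>Q. 1 / (\<mu> - 1) + (real (c i) - 1) * m) = ?r / (\<mu> - 1) + (real p + real q - ?r) * m"
  proof -
    have "(\<Sum>i\<in>Q. real (c i)) = real p + real q" using sum by (metis of_nat_add of_nat_sum)
    then show ?thesis
      by (simp add: sum.distrib sum_subtractf sum_distrib_right[symmetric])
  qed
  have gp: "g p = 1 / (\<mu> - 1) + (real p - 1) * m" using gap[of "real p"] mu by simp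
  have rhs: "real p / (\<mu> - real p) + real q / (\<mu> - 1) = g p + q / (\<mu> - 1)" by (simp add: g_def)
  \<comment> \<open>Compared with one summand \<open>p\<close> and \<open>q\<close> summands
    \<open>1\<close>, each summand beyond the first \<open>q + 1\<close> loses
    \<open>m - 1 / (\<mu> - 1)\<close>.\<close>
  have diff: "(g p + q / (\<mu> - 1)) - (\<Sum>i\<in>Q. 1 / (\<mu> - 1) + (real (c i) - 1) * m) =
    (?r - real q - 1) * (m - 1 / (\<mu> - 1))"
    unfolding lin gp by (simp add: algebra_simps diff_divide_distrib add_divide_distrib)
  have r: "?r - real q - 1 \<ge> 0" using card by simp
  have le1: "(\<Sum>i\<in>Q. g (c i)) \<le> (\<Sum>i\<in>Q. 1 / (\<mu> - 1) + (real (c i) - 1) * m)"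
    using chord by (intro sum_mono)
  have le2: "(\<Sum>i\<in>Q. 1 / (\<mu> - 1) + (real (c i) - 1) * m) \<le> g p + q / (\<mu> - 1)"
  proof -
    have "0 \<le> (?r - real q - 1) * (m - 1 / (\<mu> - 1))" using r slope by (intro mult_nonneg_nonneg) auto
    then show ?thesis using diff by linarith
  qed
  show "(\<Sum>i\<in>Q. real (c i) / (\<mu> - real (c i))) \<le> real p / (\<mu> - real p) + real q / (\<mu> - 1)"
    unfolding rhs using le1 le2 unfolding g_def by linarith
  assume "(\<Sum>i\<in>Q. real (c i) / (\<mu> - real (c i))) = real p / (\<mu> - real p) + real q / (\<mu> - 1)"
  then have eq: "(\<Sum>i\<in>Q. g (c i)) = g p + q / (\<mu> - 1)" unfolding rhs by (simp add: g_def)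
  have "(?r - real q - 1) * (m - 1 / (\<mu> - 1)) = 0" using diff eq le1 le2 by linarith
  then have "card Q = q + 1" using slope by auto
  moreover have "(\<Sum>i\<in>Q. (1 / (\<mu> - 1) + (real (c i) - 1) * m) - g (c i)) = 0"
    using eq le1 le2 by (simp add: sum_subtractf)
  then have "\<forall>i\<in>Q. (1 / (\<mu> - 1) + (real (c i) - 1) * m) - g (c i) = 0"
    using fin chord by (subst (asm) sum_nonneg_eq_0_iff) auto
  ultimately show "card Q = q + 1 \<and> (\<forall>i\<in>Q. c i = 1 \<or> c i = p)" using tight by auto
qed

text \<open>All degrees are below \<open>r\<close>, so the constant vector is a certificate for
  \<open>r\<close>; if \<open>r\<close> were reached, some degree would equal
  \<open>r\<close>.\<close>

lemma graph_rho_less: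
  assumes G: "simple_graph G" "graph_connected G" and card: "card (verts G) \<le> r"
  shows "graph_rho G < real r"
proof (rule ccontr)
  assume "\<not> ?thesis"
  then have r: "real r \<le> graph_rho G" by simp
  have fin: "finite (verts G)" and e: "\<And>e. e \<in> edges G \<Longrightarrow> e \<subseteq> verts G \<and> card e = 2"
    using G(1) unfolding simple_graph_def by auto
  obtain v where v: "v \<in> verts G" using G(2) unfolding graph_connected_def by auto
  have deg: "real (card {w \<in> verts G. {u, w} \<in> edges G}) < r" if u: "u \<in> verts G" for u
  proof -
    have "{u, u} \<notin> edges G" using e[of "{u, u}"] by auto
    then have "{w \<in> verts G. {u, w} \<in> edges G} \<subset> verts G" using u by blast
    then have "card {w \<in> verts G. {u, w} \<in> edges G} < card (verts G)" using fin by (intro psubset_card_mono)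
    then show ?thesis using card by simp
  qed
  have ev: "graph_eigenvalue G (graph_rho G)" using fin v by (intro graph_eigenvalue_rho) auto
  have "(\<Sum>w\<in>{w \<in> verts G. {v, w} \<in> edges G}. 1::real) = real r * 1"
  proof (rule certificate_tight[OF fin G(2) _ ev r, where z = "\<lambda>_. 1"])
    fix u assume "u \<in> verts G"
    then show "(\<Sum>w\<in>{w \<in> verts G. {u, w} \<in> edges G}. 1) \<le> real r * 1" using deg[of u] by simp
  qed (use v e in auto)
  then show False using deg[OF v] by simp
qed

text \<open>\<open>G\<close> is compared with the supergraph in which \<open>S\<close> is joined to
  everything and each class of \<open>R\<close> is complete. There the rows outside \<open>S\<close>
  are equalities and those in \<open>S\<close> are bounded by convexity. By \<open>rho\<close> all
  bounds become tight, so \<open>G\<close> is this supergraph and its classes have the extremal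
  orders.\<close>

lemma rho_extremal:
  fixes G :: "'a ugraph"
  assumes G: "simple_graph G" "graph_connected G"
    and n: "card (verts G) = 2 * k + 1 + P" and P: "odd P" and k: "k > 0"
    and S: "S \<subseteq> verts G" "card S = 2 * k + t"
    and R: "equiv (verts G - S) R" "t + 2 \<le> card ((verts G - S) // R)"
    and within: "\<And>u v. u \<in> verts G - S \<Longrightarrow> v \<in> verts G - S \<Longrightarrow> {u, v} \<in> edges G \<Longrightarrow> (u, v) \<in> R"
    and rho: "graph_rho (extremal (2 * k) P) \<le> graph_rho G"
  shows "graph_iso G (extremal (2 * k) P)"
proof -
  let ?V = "verts G" and ?K = "real k" and ?s = "real (2 * k + t)"
  let ?N = "\<lambda>v. {w \<in> verts G. {v, w} \<in> edges G}"
  define X where "X = ?V - S"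
  define Q where "Q = X // R"
  have fin: "finite ?V" and e: "\<And>e. e \<in> edges G \<Longrightarrow> e \<subseteq> ?V \<and> card e = 2"
    using G(1) unfolding simple_graph_def by auto
  have finX: "finite X" and finS: "finite S" using fin S X_def finite_subset by auto
  have R': "equiv X R" "R \<subseteq> X \<times> X" using R(1) equiv_type X_def by blast+
  have noloop: "{v, v} \<notin> edges G" for v using e[of "{v, v}"] by auto
  have P1: "P \<ge> 1" using P by (cases P) auto
  obtain \<mu> where mu: "2 * ?K + real P < \<mu>" "\<mu> < 2 * ?K + real P + 1"
    and mueq: "\<mu> * (\<mu> - 1) * (\<mu> - real P - 2 * ?K) = 2 * ?K * (\<mu> - real P)"
    using exists_mu[of ?K "real P"] k P1 by auto
  have mu1: "\<mu> > 1" "\<mu> > real P" using mu k by auto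
  \<comment> \<open>The row at \<open>S\<close> for \<open>t = 0\<close>; with denominators cleared
    it is the cubic equation.\<close>
  have base: "2 * ?K * (real P / (\<mu> - real P) + 1 / (\<mu> - 1)) = \<mu> - 2 * ?K"
  proof -
    have "\<mu> - 1 \<noteq> 0" "\<mu> - real P \<noteq> 0" using mu1 by auto
    then have "real P / (\<mu> - real P) + 1 / (\<mu> - 1) =
        (real P * (\<mu> - 1) + 1 * (\<mu> - real P)) / ((\<mu> - real P) * (\<mu> - 1))"
      by (rule add_frac_eq[rotated])
    moreover have "2 * ?K * (real P * (\<mu> - 1) + 1 * (\<mu> - real P)) =
        (\<mu> - 2 * ?K) * ((\<mu> - real P) * (\<mu> - 1))"
      using mueq by (simp add: algebra_simps)
    ultimately show ?thesis using mu1 by (simp add: divide_eq_eq)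
  qed
  have rho_ge: "\<mu> - 1 \<le> graph_rho G"
  proof -
    have "graph_eigenvalue (extremal (2 * k) P) (\<mu> - 1)"
      using mu1 base k by (intro extremal_eigenvalue) (auto simp: algebra_simps)
    then have "\<mu> - 1 \<le> graph_rho (extremal (2 * k) P)" by (intro graph_rho_ge) auto
    then show ?thesis using rho by simp
  qed
  have finQ: "finite Q" unfolding Q_def using finX R' by (intro finite_quotient)
  have UQ: "\<Union>Q = X" unfolding Q_def using R' by (intro Union_quotient)
  have clQ: "R `` {v} \<in> Q" if "v \<in> X" for v unfolding Q_def using that by (rule quotientI)
  have self: "v \<in> R `` {v}" if "v \<in> X" for v using R' that by (intro equiv_class_self)
  have clX: "R `` {v} \<subseteq> X" for v using R'(2) by blast
  have cls: "C = R `` {v}" if "C \<in> Q" "v \<in> C" for C v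
    using that R' unfolding Q_def by (metis Image_singleton_iff equiv_class_eq_iff quotientE)
  have finC: "finite C" "C \<noteq> {}" if "C \<in> Q" for C
    using that finX UQ in_quotient_imp_non_empty[OF R'(1)] unfolding Q_def by (auto intro: finite_subset)
  have disjQ: "\<And>C D. C \<in> Q \<Longrightarrow> D \<in> Q \<Longrightarrow> C \<noteq> D \<Longrightarrow> C \<inter> D = {}"
    using cls by blast
  have cardX: "card X = 1 + P - t" "t \<le> 1 + P"
  proof -
    have "card X = card ?V - card S" unfolding X_def using finS S by (intro card_Diff_subset)
    moreover have "card S \<le> card ?V" using fin S by (intro card_mono)
    ultimately show "card X = 1 + P - t" "t \<le> 1 + P" using n S by auto
  qed
  have sumQ: "(\<Sum>C\<in>Q. card C) = card X"
    using finC(1) disjQ unfolding UQ[symmetric]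
    by (subst card_Union_disjoint) (auto simp: pairwise_def disjnt_def)
  have "card Q \<le> card X"
  proof -
    have "card Q = (\<Sum>C\<in>Q. 1)" by simp
    also have "\<dots> \<le> (\<Sum>C\<in>Q. card C)" using finC by (intro sum_mono) (simp add: Suc_le_eq card_gt_0_iff)
    finally show ?thesis using sumQ by simp
  qed
  then have tP: "2 * t + 1 \<le> P" using R(2) cardX unfolding Q_def X_def by linarith
  \<comment> \<open>The largest order a class can have: \<open>card X = p + (t + 1)\<close>, and at
    least \<open>t + 1\<close> other classes share the rest.\<close>
  define p where "p = P - 2 * t"
  have p: "p \<ge> 1" "real p = real P - 2 * real t" using tP by (auto simp: p_def of_nat_diff)
  have pmu: "real p < \<mu>" using p mu k by linarith
  have sumQ': "(\<Sum>C\<in>Q. card C) = p + (t + 1)" using sumQ cardX tP by (simp add: p_def)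
  have cardQ: "(t + 1) + 1 \<le> card Q" using R(2) by (simp add: Q_def X_def)
  have ge1: "\<forall>C\<in>Q. card C \<ge> 1" using finC by (simp add: Suc_le_eq card_gt_0_iff)
  note convex = sum_convex_bound[OF finQ ge1 cardQ sumQ' p(1) pmu mu1(1)]
  define z where "z v = (if v \<in> S then 1 else ?s / (\<mu> - real (card (R `` {v}))))" for v
  have clmu: "real (card (R `` {v})) < \<mu>" if "v \<in> X" for v
    using convex(3)[OF clQ[OF that]] pmu by linarith
  have zpos: "z v > 0" if "v \<in> ?V" for v
  proof (cases "v \<in> S")
    case False
    then have "real (card (R `` {v})) < \<mu>" using that clmu by (simp add: X_def)
    then show ?thesis using False k by (simp add: z_def)
  qed (simp add: z_def)
  have zX: "(\<Sum>v\<in>X. z v) = ?s * (\<Sum>C\<in>Q. real (card C) / (\<mu> - real (card C)))"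
  proof -
    have "(\<Sum>v\<in>X. z v) = (\<Sum>C\<in>Q. \<Sum>v\<in>C. z v)"
      unfolding UQ[symmetric] using finC(1) disjQ by (intro sum.Union_disjoint[unfolded comp_def]) auto
    also have "\<dots> = (\<Sum>C\<in>Q. \<Sum>v\<in>C. ?s / (\<mu> - real (card C)))"
    proof (intro sum.cong refl)
      fix C v assume C: "C \<in> Q" "v \<in> C"
      then have "v \<notin> S" using UQ X_def by auto
      then show "z v = ?s / (\<mu> - real (card C))" using cls[OF C] by (simp add: z_def)
    qed
    also have "\<dots> = ?s * (\<Sum>C\<in>Q. real (card C) / (\<mu> - real (card C)))"
      by (simp add: sum_distrib_left mult_ac)
    finally show ?thesis .
  qed
  \<comment> \<open>Neighbourhoods in the supergraph of \<open>G\<close> with all edges at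
    \<open>S\<close> and inside the classes.\<close>
  define B where "B v = (if v \<in> S then ?V - {v} else S \<union> (R `` {v} - {v}))" for v
  have BV: "B v \<subseteq> ?V" for v using S clX[of v] unfolding B_def X_def by auto
  have NB: "?N v \<subseteq> B v" if "v \<in> ?V" for v
  proof
    fix w assume w: "w \<in> ?N v"
    then have "w \<noteq> v" using noloop by auto
    then show "w \<in> B v" using w that within[of v w] unfolding B_def by auto
  qed
  have sumS: "(\<Sum>v\<in>S. z v) = ?s" using S by (simp add: z_def)
  \<comment> \<open>On a class of order \<open>c\<close> the weight is chosen so that
    \<open>S\<close> contributes \<open>(\<mu> - c) * z v\<close>; the rest of the class adds
    \<open>(c - 1) * z v\<close>.\<close>
  have BX: "(\<Sum>w\<in>B v. z w) = (\<mu> - 1) * z v" if v: "v \<in> X" for v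
  proof -
    let ?c = "real (card (R `` {v}))"
    have vS: "v \<notin> S" using v X_def by auto
    have "(\<Sum>w\<in>B v. z w) = ?s + (\<Sum>w\<in>R `` {v} - {v}. z w)"
      using sumS finS clX[of v] finX vS finite_subset unfolding B_def X_def
      by (simp, subst sum.union_disjoint) auto
    also have "(\<Sum>w\<in>R `` {v} - {v}. z w) = (\<Sum>w\<in>R `` {v} - {v}. z v)"
    proof (intro sum.cong refl)
      fix w assume w: "w \<in> R `` {v} - {v}"
      then have "R `` {w} = R `` {v}" using cls[OF clQ[OF v], of w] by simp
      moreover have "w \<notin> S" using w clX[of v] X_def by auto
      ultimately show "z w = z v" using vS by (simp add: z_def)
    qed
    also have "\<dots> = (?c - 1) * z v"
      using self[OF v] finC(1)[OF clQ[OF v]] bspec[OF ge1 clQ[OF v]] by (simp add: of_nat_diff)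
    also have "?s = (\<mu> - ?c) * z v" using vS clmu[OF v] by (simp add: z_def)
    finally show ?thesis by (simp add: algebra_simps)
  qed
  have BS: "(\<Sum>w\<in>B v. z w) = ?s - 1 + ?s * (\<Sum>C\<in>Q. real (card C) / (\<mu> - real (card C)))"
    if v: "v \<in> S" for v
  proof -
    have "?V - {v} = (S - {v}) \<union> X" using S v X_def by auto
    then have "(\<Sum>w\<in>B v. z w) = (\<Sum>w\<in>S - {v}. z w) + (\<Sum>w\<in>X. z w)"
      using v finS finX unfolding B_def X_def by (simp, subst sum.union_disjoint) auto
    also have "(\<Sum>w\<in>S - {v}. z w) = ?s - 1" 
      unfolding sum_diff1[OF finS] sumS using v by (simp add: z_def)
    finally show ?thesis using zX by simp
  qed
  have Sbound: "?s * (real p / (\<mu> - real p) + real (t + 1) / (\<mu> - 1)) \<le> \<mu> - ?s"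
    and Sstrict: "t > 0 \<Longrightarrow> ?s * (real p / (\<mu> - real p) + real (t + 1) / (\<mu> - 1)) < \<mu> - ?s"
  proof -
    show strict: "?s * (real p / (\<mu> - real p) + real (t + 1) / (\<mu> - 1)) < \<mu> - ?s" if t: "t > 0"
    proof -
      \<comment> \<open>\<open>t > 0\<close> gives \<open>P \<ge> 3\<close>, and parity excludes
        \<open>4\<close>.\<close>
      have "P \<ge> 3" "P \<noteq> 4" using tP t P by auto
      then have "real P = 3 \<or> real P \<ge> 5" by linarith
      moreover have "2 * real t + 1 \<le> real P" using tP by linarith
      ultimately show ?thesis using row_sum_strict[of ?K "real P" "real t" \<mu>] k t mu mueq p(2) by (simp add: add_ac)
    qed
    show "?s * (real p / (\<mu> - real p) + real (t + 1) / (\<mu> - 1)) \<le> \<mu> - ?s"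
    proof (cases "t = 0")
      case True
      then show ?thesis using base by (simp add: p_def)
    next
      case False
      then show ?thesis using strict by simp
    qed
  qed
  have row: "(\<Sum>w\<in>B v. z w) \<le> (\<mu> - 1) * z v" if v: "v \<in> ?V" for v
  proof (cases "v \<in> S")
    case True
    have "?s * (\<Sum>C\<in>Q. real (card C) / (\<mu> - real (card C))) \<le>
      ?s * (real p / (\<mu> - real p) + real (t + 1) / (\<mu> - 1))"
      using convex(1) by (intro mult_left_mono) auto
    then show ?thesis using BS[OF True] Sbound True by (simp add: z_def)
  next
    case False
    then show ?thesis using BX[of v] v X_def by simp
  qed
  have Nle: "(\<Sum>w\<in>?N v. z w) \<le> (\<Sum>w\<in>B v. z w)" if v: "v \<in> ?V" for v
    using NB[OF v] BV[of v] fin zpos by (intro sum_mono2) (auto intro: finite_subset less_imp_le)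
  have ev: "graph_eigenvalue G (graph_rho G)" using fin n by (intro graph_eigenvalue_rho) auto
  have tight: "(\<Sum>w\<in>?N v. z w) = (\<mu> - 1) * z v" if "v \<in> ?V" for v
  proof (rule certificate_tight[OF fin G(2) _ ev rho_ge _ zpos _ that])
    show "(\<Sum>w\<in>?N u. z w) \<le> (\<mu> - 1) * z u" if "u \<in> ?V" for u
      using Nle[OF that] row[OF that] by linarith
  qed (use e mu1 in auto)
  \<comment> \<open>The sums over both neighbourhoods agree and \<open>z\<close> is positive, so no
    edge of the supergraph is missing.\<close>
  have NeqB: "?N v = B v" if v: "v \<in> ?V" for v
    using sum_eq_imp_set_eq[OF _ NB[OF v], of z] BV[of v] fin zpos tight[OF v] Nle[OF v] row[OF v]
    by (metis (no_types, lifting) finite_subset order_antisym subsetD)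
  \<comment> \<open>\<open>S\<close> is nonempty as \<open>k > 0\<close>. Equality in the row of
    \<open>s0\<close> rules out \<open>t > 0\<close> and makes the convexity bound tight.\<close>
  obtain s0 where s0: "s0 \<in> S" using S(2) k by (metis card.empty add_is_0 ex_in_conv mult_is_0 neq0_conv zero_neq_numeral)
  have "?s * (\<Sum>C\<in>Q. real (card C) / (\<mu> - real (card C))) = \<mu> - ?s"
  proof -
    have "s0 \<in> ?V" using s0 S by auto
    then have "(\<Sum>w\<in>B s0. z w) = \<mu> - 1" using tight[of s0] NeqB[of s0] s0 by (simp add: z_def)
    then show ?thesis using BS[OF s0] by simp
  qed
  moreover have "?s > 0" using k by simp
  moreover have "?s * (\<Sum>C\<in>Q. real (card C) / (\<mu> - real (card C))) \<le>
      ?s * (real p / (\<mu> - real p) + real (t + 1) / (\<mu> - 1))"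
    using convex(1) by (intro mult_left_mono) auto
  ultimately have t0: "t = 0" and
    eqQ: "(\<Sum>C\<in>Q. real (card C) / (\<mu> - real (card C))) = real p / (\<mu> - real p) + real (t + 1) / (\<mu> - 1)"
    using Sbound Sstrict by (fastforce, smt (verit) mult_left_cancel)
  have Q2: "card Q = 2" and sizes: "\<And>C. C \<in> Q \<Longrightarrow> card C = 1 \<or> card C = P"
    using convex(2)[OF eqQ] t0 by (auto simp: p_def)
  \<comment> \<open>The two orders are \<open>1\<close> or \<open>P\<close> and add up to
    \<open>P + 1\<close>.\<close>
  obtain C0 C where CC: "Q = {C0, C}" "C0 \<noteq> C" and c: "card C0 = 1" "card C = P"
  proof -
    obtain A D where AD: "Q = {A, D}" "A \<noteq> D" using Q2 by (meson card_2_iff)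
    then have "card A + card D = P + 1" using sumQ' t0 by (simp add: p_def)
    then show thesis using that[of A D] that[of D A] AD sizes[of A] sizes[of D] by (auto simp: insert_commute)
  qed
  obtain v0 where v0: "C0 = {v0}" using c(1) by (auto simp: card_1_singleton_iff)
  have XC: "X = {v0} \<union> C" using UQ CC v0 by auto
  have v0C: "v0 \<notin> C" using disjQ[of C0 C] CC v0 by auto
  have cl0: "R `` {v0} = {v0}" using cls[of C0 v0] CC v0 by auto
  have clC: "R `` {v} = C" if "v \<in> C" for v using cls[of C v] CC that by auto
  have "graph_iso G (extremal (card S) (card C))"
  proof (rule iso_extremalI[where ?v0.0 = v0])
    show "?V = S \<union> C \<union> {v0}" using XC X_def S by auto
    show "S \<inter> C = {}" "v0 \<notin> S" using XC X_def by auto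
    show "finite C" using XC finX by auto
    fix u v assume u: "u \<in> ?V" and v: "v \<in> ?V"
    have "{u, v} \<in> edges G \<longleftrightarrow> v \<in> B u" using NeqB[OF u] v by auto
    also have "\<dots> \<longleftrightarrow> u \<noteq> v \<and> \<not> (u = v0 \<and> v \<in> C) \<and> \<not> (v = v0 \<and> u \<in> C)"
    proof -
      have "u \<in> S \<or> u = v0 \<or> u \<in> C" "v \<in> S \<or> v = v0 \<or> v \<in> C" using u v XC X_def by auto
      moreover have "v0 \<notin> S" "S \<inter> C = {}" using XC X_def by auto
      ultimately show ?thesis unfolding B_def using v0C cl0 clC[of u] v by auto
    qed
    finally show "{u, v} \<in> edges G \<longleftrightarrow> u \<noteq> v \<and> \<not> (u = v0 \<and> v \<in> C) \<and> \<not> (v = v0 \<and> u \<in> C)" .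
  qed (use finS v0C in auto)
  then show ?thesis using S(2) t0 c by simp
qed

theorem theorem1p4:
  fixes k n :: nat and G :: "'a ugraph"
  assumes "k > 0" and "n > 0" and "even n"
    and "simple_graph G" and "graph_connected G" and "card (verts G) = n"
    and "graph_rho G \<ge>
      graph_rho (graph_join (complete_graph (2 * k))
        (graph_union (complete_graph (n - 2 * k - 1)) (complete_graph 1)))"
    and "\<not> graph_iso G (graph_join (complete_graph (2 * k))
        (graph_union (complete_graph (n - 2 * k - 1)) (complete_graph 1)))"
  shows "k_extendable k G"
proof (cases "2 * k + 2 \<le> n")
  case False
  then have le: "n \<le> 2 * k" using assms(3) by (cases "n = 2 * k + 1") auto
  \<comment> \<open>Here \<open>n - 2 * k - 1\<close> is truncated to \<open>0\<close>, so the
    comparison graph is complete on \<open>2 * k + 1\<close> vertices, with eigenvalue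
    \<open>2 * k\<close>. A connected graph on at most \<open>2 * k\<close> vertices stays below
    that.\<close>
  have "graph_eigenvalue (extremal (2 * k) (n - 2 * k - 1)) (real (2 * k + 1) - 1)"
    using le assms(1) by (intro extremal_eigenvalue) auto
  then have "real (2 * k) \<le> graph_rho G" using graph_rho_ge[of "extremal (2 * k) (n - 2 * k - 1)"] assms(7) by fastforce
  then show ?thesis using graph_rho_less[of G "2 * k"] assms le by simp
next
  case True
  show ?thesis
  proof (rule k_extendableI[OF assms(4)])
    show "2 * k + 2 \<le> card (verts G)" using True assms by simp
    fix U assume U: "U \<subseteq> verts G" "card U = 2 * k"
    have finV: "finite (verts G)" using assms(4) unfolding simple_graph_def by simp
    have finU: "finite U" using U finV finite_subset by blast
    show "paired (edges G) (verts G - U)"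
    proof (rule ccontr)
      assume no: "\<not> ?thesis"
      have "card (verts G - U) = n - 2 * k" using U finU assms(6) by (simp add: card_Diff_subset)
      then have "even (card (verts G - U))" using assms(3) by simp
      from unpaired_classes[OF _ this no] finV obtain T R where
        T: "T \<subseteq> verts G - U" and R: "equiv (verts G - U - T) R" "card T + 2 \<le> card ((verts G - U - T) // R)"
        and within: "\<And>u v. u \<in> verts G - U - T \<Longrightarrow> v \<in> verts G - U - T \<Longrightarrow> {u, v} \<in> edges G \<Longrightarrow> (u, v) \<in> R"
        by (metis finite_Diff)
      have diff: "verts G - (U \<union> T) = verts G - U - T" by blast
      have "finite T" using T finV finite_subset by blast
      then have card: "card (U \<union> T) = 2 * k + card T" using T U finU by (subst card_Un_disjoint) auto
      have "graph_iso G (extremal (2 * k) (n - 2 * k - 1))"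
      proof (rule rho_extremal[OF assms(4,5) _ _ assms(1) _ card, of _ R])
        show "card (verts G) = 2 * k + 1 + (n - 2 * k - 1)" using True assms(6) by simp
        show "odd (n - 2 * k - 1)" using True assms(3) by simp
        show "U \<union> T \<subseteq> verts G" using U T by auto
      qed (use R within assms(7) in \<open>simp_all add: diff\<close>)
      then show False using assms(8) by simp
    qed
  qed
qed

end
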